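(* Let $m\ge 6$. Then, as a decomposition into $\mathfrak{so}(m)$-submodules, $$\mathcal{P}_1(\mathbb{R}^{2m},\mathbb{S}_0^\infty)=\bigoplus_{j=0}^\infty R^j(\nu_1'\oplus\nu_2')\ \oplus\ \bigoplus_{j=0}^\infty\bigoplus_{a=2}^\infty R^j(\nu_1\oplus\nu_2),$$ where $\nu_1'=(1)_x$, $\nu_2'=(1)_x\otimes(1)_z$, and, for each $a\ge2$, $\nu_1=(1)_x\otimes(a)_z$ and $\nu_2=\Pi_L\big((1)_y\otimes(a-2)_z\big)$.
   Context: Let $\underline x,\underline y,\underline z\in\mathbb{R}^m$ be three vector variables, $\langle\cdot,\cdot\rangle$ the standard bilinear pairing, $\underline\partial_x=(\partial_{x_1},\dots,\partial_{x_m})$ etc., $\mathbb{E}_x=\sum_jx_j\partial_{x_j}$ etc., $\Delta_z=\sum_j\partial_{z_j}^2$. $\mathbb{S}_0^\infty=\mathcal{P}(\mathbb{R}^m,\mathbb{C})$ is the space of complex polynomials in $\underline z$, and $\mathcal{P}_1(\mathbb{R}^{2m},\mathbb{S}_0^\infty)$ is the space of complex polynomials in $(\underline x,\underline y,\underline z)$ homogeneous of total degree $1$ in $(\underline x,\underline y)$. The algebra $\mathfrak{so}(m)$ acts by simultaneous infinitesimal rotations of $\underline x,\underline y,\underline z$. Operators: $L=\langle\underline x,\underline\partial_y\rangle-\frac12\Delta_z$, $R=\langle\underline y,\underline\partial_x\rangle+\frac12|\underline z|^2$, $\mathcal{E}=\mathbb{E}_y-\mathbb{E}_x+\mathbb{E}_z+\frac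 m2$. $(a)_z$ denotes the space $\mathcal{H}_a$ of complex harmonic polynomials in $\underline z$ homogeneous of degree $a$; $(1)_x=\mathrm{span}_{\mathbb{C}}\{x_1,\dots,x_m\}$ and $(1)_y=\mathrm{span}_{\mathbb{C}}\{y_1,\dots,y_m\}$. Tensor products are realised as spaces of products of polynomials, e.g. $(1)_x\otimes(a)_z=\mathrm{span}\{x_jH(\underline z): 1\le j\le m,\ H\in\mathcal{H}_a\}$. $\Pi_L$ is the (truncated) projection operator $\Pi_L=1+\frac{1}{\mathcal{E}-2}RL$ (the fraction means: apply $RL$, then $(\mathcal{E}-2)^{-1}$); explicitly, for $H_a\in\mathcal{H}_a$, $\Pi_L(y_iH_a)=\frac{(2a+m)y_iH_a+x_i|\underline z|^2H_a}{2a+m-2}$. *)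

theory Defs
  imports "HOL-Analysis.Analysis" "HOL-Library.Poly_Mapping" "HOL-Library.Set_Algebras"
begin

section \<open>Complex polynomials in three vector variables\<close>

text \<open>
  The dimension \<open>m\<close> is \<open>CARD('m)\<close>.  A polynomial maps each monomial (an exponent function on
  the \<open>3m\<close> variables) to its coefficient; multiplication of \<^typ>\<open>('a \<Rightarrow>\<^sub>0 nat) \<Rightarrow>\<^sub>0 complex\<close>
  is the convolution product, so this is the polynomial ring.
\<close>

datatype 'm var = VX 'm | VY 'm | VZ 'm

type_synonym 'm cpoly = "('m var \<Rightarrow>\<^sub>0 nat) \<Rightarrow>\<^sub>0 complex"

definition Var :: "'m var \<Rightarrow> 'm cpoly" where
  "Var v = Poly_Mapping.single (Poly_Mapping.single v 1) 1"

abbreviation px :: "'m \<Rightarrow> 'm cpoly" where "px j \<equiv> Var (VX j)"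
abbreviation py :: "'m \<Rightarrow> 'm cpoly" where "py j \<equiv> Var (VY j)"
abbreviation pz :: "'m \<Rightarrow> 'm cpoly" where "pz j \<equiv> Var (VZ j)"

definition cscale :: "complex \<Rightarrow> 'm cpoly \<Rightarrow> 'm cpoly" (infixr \<open>*\<^sub>P\<close> 75) where
  "c *\<^sub>P p = Poly_Mapping.single 0 c * p"

global_interpretation cpoly: vector_space "cscale :: complex \<Rightarrow> 'm cpoly \<Rightarrow> 'm cpoly"
  defines cpoly_span = cpoly.span
    and cpoly_subspace = cpoly.subspace
  by unfold_locales
    (simp_all add: cscale_def algebra_simps single_add mult_single flip: mult.assoc)

text \<open>
  Formal partial derivative; the truncated subtraction in the exponent is harmless, because the
  coefficient vanishes whenever \<open>v\<close> does not occur in \<open>t\<close>.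
\<close>

definition pd :: "'m var \<Rightarrow> 'm cpoly \<Rightarrow> 'm cpoly" where
  "pd v p = (\<Sum>t\<in>Poly_Mapping.keys p.
     Poly_Mapping.single (t - Poly_Mapping.single v 1)
       (of_nat (Poly_Mapping.lookup t v) * Poly_Mapping.lookup p t))"

definition deg_x :: "('m::finite var \<Rightarrow>\<^sub>0 nat) \<Rightarrow> nat" where
  "deg_x t = (\<Sum>j\<in>UNIV. Poly_Mapping.lookup t (VX j))"
definition deg_y :: "('m::finite var \<Rightarrow>\<^sub>0 nat) \<Rightarrow> nat" where
  "deg_y t = (\<Sum>j\<in>UNIV. Poly_Mapping.lookup t (VY j))"
definition deg_z :: "('m::finite var \<Rightarrow>\<^sub>0 nat) \<Rightarrow> nat" where
  "deg_z t = (\<Sum>j\<in>UNIV. Poly_Mapping.lookup t (VZ j))"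

section \<open>Operators\<close>

definition Lap_z :: "'m::finite cpoly \<Rightarrow> 'm cpoly" where
  "Lap_z p = (\<Sum>j\<in>UNIV. pd (VZ j) (pd (VZ j) p))"

definition norm2_z :: "'m::finite cpoly" where
  "norm2_z = (\<Sum>j\<in>UNIV. (pz j)\<^sup>2)"

definition Euler_x :: "'m::finite cpoly \<Rightarrow> 'm cpoly" where
  "Euler_x p = (\<Sum>j\<in>UNIV. px j * pd (VX j) p)"
definition Euler_y :: "'m::finite cpoly \<Rightarrow> 'm cpoly" where
  "Euler_y p = (\<Sum>j\<in>UNIV. py j * pd (VY j) p)"
definition Euler_z :: "'m::finite cpoly \<Rightarrow> 'm cpoly" where
  "Euler_z p = (\<Sum>j\<in>UNIV. pz j * pd (VZ j) p)"

definition op_L :: "'m::finite cpoly \<Rightarrow> 'm cpoly" where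
  "op_L p = (\<Sum>j\<in>UNIV. px j * pd (VY j) p) - (1/2) *\<^sub>P Lap_z p"

definition op_R :: "'m::finite cpoly \<Rightarrow> 'm cpoly" where
  "op_R p = (\<Sum>j\<in>UNIV. py j * pd (VX j) p) + (1/2) *\<^sub>P (norm2_z * p)"

definition op_E :: "'m::finite cpoly \<Rightarrow> 'm cpoly" where
  "op_E p = Euler_y p - Euler_x p + Euler_z p + (of_nat CARD('m) / 2) *\<^sub>P p"

section \<open>Spaces of polynomials\<close>

definition P1 :: "'m::finite cpoly set" where
  "P1 = {p. \<forall>t\<in>Poly_Mapping.keys p. deg_x t + deg_y t = 1}"

definition harm_z :: "nat \<Rightarrow> 'm::finite cpoly set" where
  "harm_z a = {p. (\<forall>t\<in>Poly_Mapping.keys p. deg_x t = 0 \<and> deg_y t = 0 \<and> deg_z t = a) \<and> Lap_z p = 0}"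

definition one_x :: "'m cpoly set" where
  "one_x = cpoly_span (range px)"
definition one_y :: "'m cpoly set" where
  "one_y = cpoly_span (range py)"

definition tensor :: "'m cpoly set \<Rightarrow> 'm cpoly set \<Rightarrow> 'm cpoly set" (infixl \<open>\<otimes>\<^sub>P\<close> 70) where
  "U \<otimes>\<^sub>P W = cpoly_span {u * w |u w. u \<in> U \<and> w \<in> W}"

text \<open>
  The projection \<open>1 + (\<E> - 2)\<^sup>-\<^sup>1 R L\<close> on \<^const>\<open>P1\<close>.  The operator \<open>\<E> - 2\<close> is inverted on the
  space \<open>R L P1\<close>, which it preserves.  On all of \<open>P1\<close> it is not injective when \<open>m = 6\<close> (it kills
  \<open>x\<^sub>1, \<dots>, x\<^sub>m\<close>), but for \<open>m \<ge> 6\<close> it is injective on \<open>R L P1\<close>.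
\<close>

definition Pi_L :: "'m::finite cpoly \<Rightarrow> 'm cpoly" where
  "Pi_L p = p + inv_into ((\<lambda>q. op_R (op_L q)) ` P1) (\<lambda>q. op_E q - 2 *\<^sub>P q) (op_R (op_L p))"

section \<open>Modules over \<open>so(m)\<close> and direct sums\<close>

text \<open>
  Derivative at \<open>s = 0\<close> of \<open>p (e\<^sup>-\<^sup>s\<^sup>A x, e\<^sup>-\<^sup>s\<^sup>A y, e\<^sup>-\<^sup>s\<^sup>A z)\<close> for a skew-symmetric matrix \<open>A\<close>
  (the sign disappears because \<open>A\<close> is skew).
\<close>

definition so_act :: "real ^ 'm ^ 'm \<Rightarrow> 'm::finite cpoly \<Rightarrow> 'm cpoly" where
  "so_act A p = (\<Sum>i\<in>UNIV. \<Sum>j\<in>UNIV. complex_of_real (A $ i $ j) *\<^sub>P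
     (px i * pd (VX j) p + py i * pd (VY j) p + pz i * pd (VZ j) p))"

definition so_submodule :: "'m::finite cpoly set \<Rightarrow> bool" where
  "so_submodule W \<longleftrightarrow> cpoly_subspace W \<and>
     (\<forall>A :: real ^ 'm ^ 'm. transpose A = - A \<longrightarrow> (\<forall>p\<in>W. so_act A p \<in> W))"

text \<open>The external direct sum of a family of subspaces: finitely supported choices.\<close>

definition ext_sum :: "'i set \<Rightarrow> ('i \<Rightarrow> 'm cpoly set) \<Rightarrow> ('i \<Rightarrow> 'm cpoly) set" where
  "ext_sum I W = {f. (\<forall>i\<in>I. f i \<in> W i) \<and> (\<forall>i. i \<notin> I \<longrightarrow> f i = 0) \<and> finite {i. f i \<noteq> 0}}"

definition so_direct_sum :: "'m::finite cpoly set \<Rightarrow> 'i set \<Rightarrow> ('i \<Rightarrow> 'm cpoly set) \<Rightarrow> bool" where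
  "so_direct_sum V I W \<longleftrightarrow> so_submodule V \<and> (\<forall>i\<in>I. so_submodule (W i)) \<and>
     bij_betw (\<lambda>f. \<Sum>i | f i \<noteq> 0. f i) (ext_sum I W) V"

definition nu1' :: "'m::finite cpoly set" where
  "nu1' = one_x"
definition nu2' :: "'m::finite cpoly set" where
  "nu2' = one_x \<otimes>\<^sub>P harm_z 1"
definition nu1 :: "nat \<Rightarrow> 'm::finite cpoly set" where
  "nu1 a = one_x \<otimes>\<^sub>P harm_z a"
text \<open>Only used for \<open>a \<ge> 2\<close>, so that \<open>a - 2\<close> is not truncated.\<close>
definition nu2 :: "nat \<Rightarrow> 'm::finite cpoly set" where
  "nu2 a = Pi_L ` (one_y \<otimes>\<^sub>P harm_z (a - 2))"

end

theory Submission
  imports Defs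
begin

text \<open>
  The operators satisfy the \<open>sl(2)\<close> relations \<open>[L, R] = - \<E>\<close>, \<open>[\<E>, R] = 2R\<close>, \<open>[\<E>, L] = - 2L\<close>
  and commute with \<open>so(m)\<close>.  On \<open>P\<^sub>1\<close> the operator \<open>\<E>\<close> is diagonalisable with eigenvalues at least
  \<open>m/2 - 1 > 0\<close>, so for a singular vector \<open>p\<close> (\<open>L p = 0\<close>) of weight \<open>\<lambda>\<close> the factors in
  \<open>L R\<^sup>j\<^sup>+\<^sup>1 p = - (j + 1) (\<lambda> + j) R\<^sup>j p\<close> never vanish.  By induction on the weight, every weight vector \<open>p\<close>
  can be written as \<open>R q\<close> plus a singular vector: choose \<open>q\<close> with \<open>L R q = L p\<close> in the span of the
  \<open>R\<^sup>j\<close> of singular vectors.  Hence these span \<open>P\<^sub>1\<close>, and the Casimir operator together with \<open>\<E>\<close>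
  separates the summands.

  It remains to find the singular vectors of weight \<open>a - 1 + m/2\<close>.  Differentiating
  \<open>L (\<Sum> x\<^sub>j f\<^sub>j + y\<^sub>j g\<^sub>j) = 0\<close> in \<open>y\<^sub>k\<close> and \<open>x\<^sub>k\<close> shows that all \<open>g\<^sub>j\<close> are harmonic of degree \<open>a - 2\<close>
  and that, when they vanish, all \<open>f\<^sub>j\<close> are harmonic of degree \<open>a\<close>.  As \<open>\<Pi>\<^sub>L\<close> sends \<open>\<Sum> y\<^sub>j g\<^sub>j\<close> to a singular
  vector whose \<open>y\<close>-part is a nonzero multiple of it, subtracting such a vector removes the \<open>g\<^sub>j\<close>.
\<close>

section \<open>Derivations of the polynomial ring\<close>

abbreviation cpoly_linear :: "('m cpoly \<Rightarrow> 'm cpoly) \<Rightarrow> bool" where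
  "cpoly_linear T \<equiv> module_hom cscale cscale T"

lemma cpoly_linearI:
  assumes "\<And>p q. T (p + q) = T p + T q" "\<And>c p. T (c *\<^sub>P p) = c *\<^sub>P T p"
  shows "cpoly_linear T"
  using assms cpoly.module_axioms by (auto simp: module_hom_def module_hom_axioms_def)

lemmas lin_add = module_hom.add
lemmas lin_diff = module_hom.diff
lemmas lin_scale = module_hom.scale
lemmas lin_sum = module_hom.sum
lemmas lin_zero = module_hom.zero

lemma cscale_mult_left: "(c *\<^sub>P p) * q = c *\<^sub>P (p * q)"
  by (simp add: cscale_def mult.assoc)

lemma cscale_mult_right: "p * (c *\<^sub>P q) = c *\<^sub>P (p * q)"
  by (simp add: cscale_def algebra_simps)

lemma cscale_single: "c *\<^sub>P Poly_Mapping.single t d = Poly_Mapping.single t (c * d)"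
  by (simp add: cscale_def mult_single)

lemma of_nat_cscale: "of_nat n *\<^sub>P p = of_nat n * p"
  by (simp add: cscale_def)

lemma sum_single_lookup:
  "p = (\<Sum>t\<in>Poly_Mapping.keys p. Poly_Mapping.single t (Poly_Mapping.lookup p t))"
  by (rule poly_mapping_eqI)
     (simp add: lookup_sum lookup_single when_def in_keys_iff)

lemma cpoly_monomial_induct [case_names single add]:
  fixes p :: "'m cpoly"
  assumes "\<And>t c. P (Poly_Mapping.single t c)" "\<And>p q. P p \<Longrightarrow> P q \<Longrightarrow> P (p + q)"
  shows "P p"
proof -
  have 0: "P 0" using assms(1)[of 0 0] by simp
  have "P (\<Sum>t\<in>S. Poly_Mapping.single t (f t))" if "finite S" for S f
    using that by (induction S rule: finite_induct) (auto intro: assms 0)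
  then show ?thesis by (subst sum_single_lookup) simp
qed

lemma lookup_cscale: "Poly_Mapping.lookup (c *\<^sub>P p) t = c * Poly_Mapping.lookup p t"
  by (induction p rule: cpoly_monomial_induct)
     (simp_all add: cscale_single lookup_single when_def cpoly.scale_right_distrib lookup_add algebra_simps)

lemma Var_mult_single:
  "Var v * Poly_Mapping.single t c = Poly_Mapping.single (Poly_Mapping.single v 1 + t) c"
  by (simp add: Var_def mult_single)

text \<open>Suited to multiplicative statements: product rules and equality of derivations then only
  have to be checked for multiplication by one variable.\<close>

lemma cpoly_induct [case_names const add Var]:
  fixes p :: "'m cpoly"
  assumes const: "\<And>c. P (Poly_Mapping.single 0 c)" and add: "\<And>p q. P p \<Longrightarrow> P q \<Longrightarrow> P (p + q)"
    and Var: "\<And>v p. P p \<Longrightarrow> P (Var v * p)"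
  shows "P p"
proof (induction p rule: cpoly_monomial_induct)
  case (single t c)
  have step: "P (Poly_Mapping.single (t + Poly_Mapping.single v n) c)"
    if "P (Poly_Mapping.single t c)" for t v n
  proof (induction n)
    case (Suc n)
    have "Poly_Mapping.single (t + Poly_Mapping.single v (Suc n)) c
        = Var v * Poly_Mapping.single (t + Poly_Mapping.single v n) c"
      by (simp add: Var_mult_single ac_simps flip: single_add)
    with Suc Var show ?case by simp
  qed (use that in simp)
  show ?case
  proof (induction t rule: Poly_Mapping.update_induct)
    case (update t v n)
    \<comment> \<open>Here \<open>v\<close> does not occur in \<open>t\<close>, so overwriting its
      exponent amounts to adding to it.\<close>
    have "Poly_Mapping.update v n t = t + Poly_Mapping.single v n"
      by (rule poly_mapping_eqI)
         (use update in \<open>auto simp: lookup_update lookup_add lookup_single when_def in_keys_iff\<close>)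
    with step update show ?case by simp
  qed (rule const)
qed (rule add)

section \<open>Formal partial derivatives and general derivations\<close>

lemma pd_single:
  "pd v (Poly_Mapping.single t c)
    = Poly_Mapping.single (t - Poly_Mapping.single v 1) (of_nat (Poly_Mapping.lookup t v) * c)"
  by (cases "c = 0") (simp_all add: pd_def)

lemma lookup_pd:
  "Poly_Mapping.lookup (pd v p) t
    = of_nat (Suc (Poly_Mapping.lookup t v)) * Poly_Mapping.lookup p (t + Poly_Mapping.single v 1)"
proof -
  let ?s = "t + Poly_Mapping.single v 1"
  \<comment> \<open>Truncated subtraction can also reach \<open>t\<close> from a monomial without
    \<open>v\<close>, but such a term carries the factor 0. Among the others only \<open>?s\<close>
    is sent to \<open>t\<close>.\<close>
  have *: "s = ?s" if "s - Poly_Mapping.single v 1 = t" "Poly_Mapping.lookup s v \<noteq> 0"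
    for s :: "'a var \<Rightarrow>\<^sub>0 nat"
    by (rule poly_mapping_eqI)
       (use that in \<open>auto simp: lookup_add lookup_single lookup_minus when_def\<close>)
  have "Poly_Mapping.lookup (pd v p) t = (\<Sum>s\<in>Poly_Mapping.keys p.
      if s = ?s then of_nat (Poly_Mapping.lookup s v) * Poly_Mapping.lookup p s else 0)"
    unfolding pd_def lookup_sum lookup_single when_def
    by (intro sum.cong refl) (use * in auto)
  also have "\<dots> = of_nat (Suc (Poly_Mapping.lookup t v)) * Poly_Mapping.lookup p ?s"
    by (auto simp: in_keys_iff lookup_add)
  finally show ?thesis .
qed

lemma linear_pd: "cpoly_linear (pd v)"
  by (rule cpoly_linearI; rule poly_mapping_eqI)
     (simp_all add: lookup_pd lookup_add lookup_cscale algebra_simps)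

lemma pd_Var: "pd u (Var v) = (if u = v then 1 else 0)"
  by (auto simp: Var_def pd_single lookup_single)

lemma pd_Var_mult: "pd u (Var v * p) = (if u = v then p else 0) + Var v * pd u p"
proof (induction p rule: cpoly_monomial_induct)
  case (single t c)
  \<comment> \<open>Moving the truncated subtraction inside fails only if \<open>u = v\<close> and
    \<open>u\<close> does not occur in \<open>t\<close>. In that case \<open>pd u\<close> kills the
    monomial, and the first summand alone accounts for the result.\<close>
  have "Poly_Mapping.single v 1 + t - Poly_Mapping.single u 1
      = Poly_Mapping.single v 1 + (t - Poly_Mapping.single u 1)"
    if "u \<noteq> v \<or> Poly_Mapping.lookup t u \<noteq> 0"
    by (rule poly_mapping_eqI)
       (use that in \<open>auto simp: lookup_add lookup_minus lookup_single when_def\<close>)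
  then show ?case
    by (cases "Poly_Mapping.lookup t u = 0")
       (auto simp: Var_mult_single pd_single lookup_add lookup_single algebra_simps single_add
          simp flip: single_add)
qed (simp add: algebra_simps lin_add[OF linear_pd])

lemma pd_const: "pd v (Poly_Mapping.single 0 c) = 0"
  by (simp add: pd_single)

lemma pd_commute: "pd u (pd v p) = pd v (pd u p)"
proof (cases "u = v")
  case False
  show ?thesis
    by (rule poly_mapping_eqI)
       (use False in \<open>simp add: lookup_pd lookup_add lookup_single algebra_simps\<close>)
qed simp

text \<open>Killing the constants is what makes an additive map with the product rule
  complex-linear, hence determined by its values on the variables.\<close>

definition derivation :: "('m cpoly \<Rightarrow> 'm cpoly) \<Rightarrow> bool" where
  "derivation D \<longleftrightarrow> (\<forall>p q. D (p + q) = D p + D q) \<and> (\<forall>c. D (Poly_Mapping.single 0 c) = 0) \<and>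
     (\<forall>p q. D (p * q) = D p * q + p * D q)"

lemma derivation_mult: "derivation D \<Longrightarrow> D (p * q) = D p * q + p * D q"
  and derivation_const: "derivation D \<Longrightarrow> D (Poly_Mapping.single 0 c) = 0"
  by (simp_all add: derivation_def)

lemma derivation_linear: "derivation D \<Longrightarrow> cpoly_linear D"
  by (rule cpoly_linearI) (simp_all add: derivation_def cscale_def)

lemma derivation_eqI:
  assumes "derivation D" "derivation D'" "\<And>v. D (Var v) = D' (Var v)"
  shows "D p = D' p"
  by (induction p rule: cpoly_induct) (use assms in \<open>simp_all add: derivation_def\<close>)

lemma derivation_pd: "derivation (pd v)"
proof -
  have "pd v (p * q) = pd v p * q + p * pd v q" for p q
  proof (induction p rule: cpoly_induct)
    case (const c)
    then show ?case using lin_scale[OF linear_pd, of v c q] by (simp add: cscale_def pd_const)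
  qed (simp_all add: mult.assoc distrib_left distrib_right lin_add[OF linear_pd] pd_Var_mult)
  then show ?thesis by (simp add: derivation_def pd_const lin_add[OF linear_pd])
qed

lemma derivation_plus: "derivation D \<Longrightarrow> derivation D' \<Longrightarrow> derivation (\<lambda>p. D p + D' p)"
  and derivation_minus: "derivation D \<Longrightarrow> derivation D' \<Longrightarrow> derivation (\<lambda>p. D p - D' p)"
  and derivation_times: "derivation D \<Longrightarrow> derivation (\<lambda>p. u * D p)"
  and derivation_cscale: "derivation D \<Longrightarrow> derivation (\<lambda>p. c *\<^sub>P D p)"
  and derivation_zero: "derivation (\<lambda>p. 0)"
  by (simp_all add: derivation_def algebra_simps cscale_def)

text \<open>The mixed products of \<open>D\<close> and \<open>D'\<close> occur symmetrically and
  cancel in the difference.\<close>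

lemma derivation_commutator:
  "derivation D \<Longrightarrow> derivation D' \<Longrightarrow> derivation (\<lambda>p. D (D' p) - D' (D p))"
  using lin_zero[OF derivation_linear[of D]] lin_zero[OF derivation_linear[of D']]
  by (simp add: derivation_def algebra_simps)

lemma derivation_sum: "(\<And>i. i \<in> I \<Longrightarrow> derivation (D i)) \<Longrightarrow> derivation (\<lambda>p. \<Sum>i\<in>I. D i p)"
  by (simp add: derivation_def sum.distrib sum_distrib_left sum_distrib_right)

lemmas derivation_intros = derivation_pd derivation_plus derivation_minus derivation_times
  derivation_cscale derivation_zero derivation_commutator derivation_sum

section \<open>The first-order operators and their commutators\<close>

definition x_dy :: "'m::finite cpoly \<Rightarrow> 'm cpoly" where
  "x_dy p = (\<Sum>j\<in>UNIV. px j * pd (VY j) p)"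

definition y_dx :: "'m::finite cpoly \<Rightarrow> 'm cpoly" where
  "y_dx p = (\<Sum>j\<in>UNIV. py j * pd (VX j) p)"

lemma op_L_eq: "op_L p = x_dy p - (1/2) *\<^sub>P Lap_z p"
  by (simp add: op_L_def x_dy_def)

lemma op_R_eq: "op_R p = y_dx p + (1/2) *\<^sub>P (norm2_z * p)"
  by (simp add: op_R_def y_dx_def)

lemma derivation_vector_fields:
  "derivation x_dy" "derivation y_dx" "derivation Euler_x" "derivation Euler_y"
  "derivation Euler_z" "derivation (so_act A)"
  unfolding x_dy_def y_dx_def Euler_x_def Euler_y_def Euler_z_def so_act_def
  by (intro derivation_intros)+

lemmas linear_vector_fields = derivation_vector_fields[THEN derivation_linear]

lemma vector_fields_Var:
  "x_dy (px k) = 0" "x_dy (py k) = px k" "x_dy (pz k) = 0"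
  "y_dx (px k) = py k" "y_dx (py k) = 0" "y_dx (pz k) = 0"
  "Euler_x (px k) = px k" "Euler_x (py k) = 0" "Euler_x (pz k) = 0"
  "Euler_y (px k) = 0" "Euler_y (py k) = py k" "Euler_y (pz k) = 0"
  "Euler_z (px k) = 0" "Euler_z (py k) = 0" "Euler_z (pz k) = pz k"
  by (simp_all add: x_dy_def y_dx_def Euler_x_def Euler_y_def Euler_z_def pd_Var
      if_distrib[of "(*) _"] cong: if_cong)

lemma so_act_Var:
  "so_act A (px k) = (\<Sum>i\<in>UNIV. complex_of_real (A $ i $ k) *\<^sub>P px i)"
  "so_act A (py k) = (\<Sum>i\<in>UNIV. complex_of_real (A $ i $ k) *\<^sub>P py i)"
  "so_act A (pz k) = (\<Sum>i\<in>UNIV. complex_of_real (A $ i $ k) *\<^sub>P pz i)"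
  by (simp_all add: so_act_def pd_Var if_distrib[of "(*) _"] if_distrib[of "cscale _"] cong: if_cong)

lemma linear_Lap_z: "cpoly_linear Lap_z"
  by (rule cpoly_linearI)
     (simp_all add: Lap_z_def lin_add[OF linear_pd] lin_scale[OF linear_pd] sum.distrib
       cpoly.scale_sum_right)

lemma linear_op_L: "cpoly_linear op_L"
  by (rule cpoly_linearI)
     (simp_all add: op_L_eq lin_add[OF linear_vector_fields(1)] lin_scale[OF linear_vector_fields(1)]
       lin_add[OF linear_Lap_z] lin_scale[OF linear_Lap_z] algebra_simps
       cpoly.scale_right_distrib cpoly.scale_right_diff_distrib)

lemma linear_op_R: "cpoly_linear op_R"
  by (rule cpoly_linearI)
     (simp_all add: op_R_eq lin_add[OF linear_vector_fields(2)] lin_scale[OF linear_vector_fields(2)]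
       cscale_mult_right algebra_simps cpoly.scale_right_distrib)

lemma linear_op_E: "cpoly_linear op_E"
  by (rule cpoly_linearI)
     (simp_all add: op_E_def linear_vector_fields[THEN lin_add] linear_vector_fields[THEN lin_scale]
       cpoly.scale_right_distrib cpoly.scale_right_diff_distrib)

text \<open>As the commutator of two derivations is again a derivation, a relation between vector
  fields only has to be verified on the three families of variables.\<close>

lemma commutator:
  assumes "derivation D" "derivation D'" "derivation D''"
    "\<And>k. D (D' (px k)) = D' (D (px k)) + D'' (px k)"
    "\<And>k. D (D' (py k)) = D' (D (py k)) + D'' (py k)"
    "\<And>k. D (D' (pz k)) = D' (D (pz k)) + D'' (pz k)"
  shows "D (D' p) = D' (D p) + D'' p"
proof -
  have "D (D' (Var v)) = D' (D (Var v)) + D'' (Var v)" for v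
    by (cases v) (simp_all add: assms(4-6))
  then show ?thesis
    using derivation_eqI[OF derivation_commutator[OF assms(1,2)] assms(3), of p]
    by (simp add: algebra_simps)
qed

lemma commutator_minus:
  assumes "derivation D" "derivation D'" "derivation D''"
    "\<And>k. D (D' (px k)) = D' (D (px k)) - D'' (px k)"
    "\<And>k. D (D' (py k)) = D' (D (py k)) - D'' (py k)"
    "\<And>k. D (D' (pz k)) = D' (D (pz k)) - D'' (pz k)"
  shows "D (D' p) = D' (D p) - D'' p"
  using commutator[OF assms(1,2) derivation_minus[OF derivation_zero assms(3)], of p] assms(4-6)
  by simp

lemma commutator_zero:
  assumes "derivation D" "derivation D'"
    "\<And>k. D (D' (px k)) = D' (D (px k))"
    "\<And>k. D (D' (py k)) = D' (D (py k))"
    "\<And>k. D (D' (pz k)) = D' (D (pz k))"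
  shows "D (D' p) = D' (D p)"
  using commutator[OF assms(1,2) derivation_zero, of p] assms(3-5) by simp

lemma derivation_at_0: "derivation D \<Longrightarrow> D 0 = 0"
  by (rule lin_zero[OF derivation_linear])

lemmas derivations_at_0 = derivation_vector_fields[THEN derivation_at_0]
  derivation_pd[THEN derivation_at_0]

lemma derivation_at_1: "derivation D \<Longrightarrow> D 1 = 0"
  by (metis derivation_const single_one)

lemmas derivations_at_1 = derivation_vector_fields[THEN derivation_at_1] derivation_pd[THEN derivation_at_1]

lemma numeral_cscale: "numeral n *\<^sub>P p = numeral n * p"
  by (simp add: cscale_def)

lemma x_dy_y_dx:
  "x_dy (y_dx p) = y_dx (x_dy p) + (Euler_x p - Euler_y p)"
  by (rule commutator[of x_dy y_dx "\<lambda>p. Euler_x p - Euler_y p"];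
      simp add: derivation_vector_fields derivation_pd vector_fields_Var derivations_at_0 derivations_at_1 derivation_minus)

lemma Euler_x_dy_y_dx:
  "Euler_x (x_dy p) = x_dy (Euler_x p) + x_dy p"
  "Euler_y (x_dy p) = x_dy (Euler_y p) - x_dy p"
  "Euler_z (x_dy p) = x_dy (Euler_z p)"
  "Euler_x (y_dx p) = y_dx (Euler_x p) - y_dx p"
  "Euler_y (y_dx p) = y_dx (Euler_y p) + y_dx p"
  "Euler_z (y_dx p) = y_dx (Euler_z p)"
  by (rule commutator[of Euler_x x_dy x_dy]
      commutator_minus[of Euler_y x_dy x_dy]
      commutator_zero[of Euler_z x_dy]
      commutator_minus[of Euler_x y_dx y_dx]
      commutator[of Euler_y y_dx y_dx]
      commutator_zero[of Euler_z y_dx];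
      simp add: derivation_vector_fields derivation_pd vector_fields_Var derivations_at_0 derivations_at_1)+

lemma Euler_commute:
  "Euler_x (Euler_y p) = Euler_y (Euler_x p)"
  "Euler_x (Euler_z p) = Euler_z (Euler_x p)"
  "Euler_y (Euler_z p) = Euler_z (Euler_y p)"
  by (rule commutator_zero[of Euler_x Euler_y]
      commutator_zero[of Euler_x Euler_z]
      commutator_zero[of Euler_y Euler_z];
      simp add: derivation_vector_fields derivation_pd vector_fields_Var derivations_at_0 derivations_at_1)+

lemma so_act_commute:
  "so_act A (x_dy p) = x_dy (so_act A p)"
  "so_act A (y_dx p) = y_dx (so_act A p)"
  "so_act A (Euler_x p) = Euler_x (so_act A p)"
  "so_act A (Euler_y p) = Euler_y (so_act A p)"
  "so_act A (Euler_z p) = Euler_z (so_act A p)"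
  by (rule commutator_zero[of "so_act A" x_dy]
      commutator_zero[of "so_act A" y_dx]
      commutator_zero[of "so_act A" Euler_x]
      commutator_zero[of "so_act A" Euler_y]
      commutator_zero[of "so_act A" Euler_z];
      simp add: derivation_vector_fields derivation_pd vector_fields_Var derivations_at_0 derivations_at_1
        so_act_Var linear_vector_fields[THEN lin_sum] linear_vector_fields[THEN lin_scale])+

lemma pd_VX_commute:
  "pd (VX k) (x_dy p) = x_dy (pd (VX k) p) + pd (VY k) p"
  "pd (VX k) (Euler_x p) = Euler_x (pd (VX k) p) + pd (VX k) p"
  "pd (VX k) (Euler_y p) = Euler_y (pd (VX k) p)"
  "pd (VX k) (Euler_z p) = Euler_z (pd (VX k) p)"
  by (rule commutator[of "pd (VX k)" x_dy "pd (VY k)"]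
      commutator[of "pd (VX k)" Euler_x "pd (VX k)"]
      commutator_zero[of "pd (VX k)" Euler_y]
      commutator_zero[of "pd (VX k)" Euler_z];
      simp add: derivation_vector_fields derivation_pd vector_fields_Var derivations_at_0 derivations_at_1 pd_Var)+

lemma pd_VY_commute:
  "pd (VY k) (x_dy p) = x_dy (pd (VY k) p)"
  "pd (VY k) (Euler_x p) = Euler_x (pd (VY k) p)"
  "pd (VY k) (Euler_y p) = Euler_y (pd (VY k) p) + pd (VY k) p"
  "pd (VY k) (Euler_z p) = Euler_z (pd (VY k) p)"
  by (rule commutator_zero[of "pd (VY k)" x_dy]
      commutator_zero[of "pd (VY k)" Euler_x]
      commutator[of "pd (VY k)" Euler_y "pd (VY k)"]
      commutator_zero[of "pd (VY k)" Euler_z];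
      simp add: derivation_vector_fields derivation_pd vector_fields_Var derivations_at_0 derivations_at_1 pd_Var)+

lemma pd_VZ_commute:
  "pd (VZ k) (x_dy p) = x_dy (pd (VZ k) p)"
  "pd (VZ k) (y_dx p) = y_dx (pd (VZ k) p)"
  "pd (VZ k) (Euler_x p) = Euler_x (pd (VZ k) p)"
  "pd (VZ k) (Euler_y p) = Euler_y (pd (VZ k) p)"
  "pd (VZ k) (Euler_z p) = Euler_z (pd (VZ k) p) + pd (VZ k) p"
  by (rule commutator_zero[of "pd (VZ k)" x_dy]
      commutator_zero[of "pd (VZ k)" y_dx]
      commutator_zero[of "pd (VZ k)" Euler_x]
      commutator_zero[of "pd (VZ k)" Euler_y]
      commutator[of "pd (VZ k)" Euler_z "pd (VZ k)"];
      simp add: derivation_vector_fields derivation_pd vector_fields_Var derivations_at_0 derivations_at_1 pd_Var)+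

lemma pd_VZ_so_act:
  "pd (VZ k) (so_act A p) = so_act A (pd (VZ k) p)
    + (\<Sum>l\<in>UNIV. complex_of_real (A $ k $ l) *\<^sub>P pd (VZ l) p)"
  by (rule commutator[of "pd (VZ k)" "so_act A" 
      "\<lambda>p. \<Sum>l\<in>UNIV. complex_of_real (A $ k $ l) *\<^sub>P pd (VZ l) p"];
      simp add: derivation_vector_fields derivation_pd vector_fields_Var derivations_at_0 derivations_at_1
      derivation_sum derivation_cscale so_act_Var pd_Var linear_pd[THEN lin_sum]
      linear_pd[THEN lin_scale] if_distrib[of "cscale _"] cong: if_cong)

section \<open>The Laplacian and the squared norm in z\<close>

lemma Lap_z_mult_indep:
  assumes "\<And>k. pd (VZ k) p = 0"
  shows "Lap_z (p * q) = p * Lap_z q"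
  by (simp add: Lap_z_def derivation_mult[OF derivation_pd] assms sum_distrib_left derivations_at_0)

lemma Lap_z_commute:
  assumes "cpoly_linear D" "\<And>k p. pd (VZ k) (D p) = D (pd (VZ k) p)"
  shows "Lap_z (D p) = D (Lap_z p)"
  by (simp add: Lap_z_def assms(2) lin_sum[OF assms(1)])

lemma Lap_z_derivations_commute:
  "Lap_z (x_dy p) = x_dy (Lap_z p)"
  "Lap_z (y_dx p) = y_dx (Lap_z p)"
  "Lap_z (Euler_x p) = Euler_x (Lap_z p)"
  "Lap_z (Euler_y p) = Euler_y (Lap_z p)"
  "Lap_z (pd v p) = pd v (Lap_z p)"
  by (intro Lap_z_commute linear_vector_fields linear_pd; simp add: pd_VZ_commute pd_commute)+

lemma Lap_z_Euler_z: "Lap_z (Euler_z p) = Euler_z (Lap_z p) + 2 *\<^sub>P Lap_z p"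
  by (simp add: Lap_z_def pd_VZ_commute lin_add[OF linear_pd] lin_sum[OF linear_vector_fields(5)]
      sum.distrib sum_distrib_left numeral_cscale algebra_simps)

text \<open>Interchanging the two indices turns the sum into its own negative. This is the source of
  the rotation invariance of \<open>Lap_z\<close> and \<open>norm2_z\<close>.\<close>

lemma skew_symmetric_sum:
  fixes T :: "'m::finite \<Rightarrow> 'm \<Rightarrow> 'm cpoly"
  assumes "transpose A = - A" "\<And>k l. T k l = T l k"
  shows "(\<Sum>k\<in>UNIV. \<Sum>l\<in>UNIV. complex_of_real (A $ k $ l) *\<^sub>P T k l) = 0" (is "?S = 0")
proof -
  have skew: "A $ l $ k = - A $ k $ l" for k l
    using arg_cong[OF assms(1), of "\<lambda>B. B $ k $ l"] by (simp add: transpose_def)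
  have "?S = (\<Sum>k\<in>UNIV. \<Sum>l\<in>UNIV. complex_of_real (A $ l $ k) *\<^sub>P T l k)"
    by (rule sum.swap)
  also have "\<dots> = (\<Sum>k\<in>UNIV. \<Sum>l\<in>UNIV. - (complex_of_real (A $ k $ l) *\<^sub>P T k l))"
    by (intro sum.cong refl) (subst skew, subst assms(2), simp)
  also have "\<dots> = - ?S" by (simp add: sum_negf)
  finally have "?S + ?S = 0" by (simp add: eq_neg_iff_add_eq_0)
  then have "2 *\<^sub>P ?S = 0" by (simp add: cpoly.scale_left_distrib[of 1 1, simplified])
  then show ?thesis by simp
qed

text \<open>Moving the two derivatives past \<open>so_act A\<close> leaves contractions of
  \<open>A\<close> with the symmetric matrix of second derivatives, and these vanish by
  skewness.\<close>

lemma Lap_z_so_act: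
  assumes "transpose A = - A"
  shows "Lap_z (so_act A p) = so_act A (Lap_z p)"
proof -
  have "Lap_z (so_act A p) = so_act A (Lap_z p)
      + ((\<Sum>k\<in>UNIV. \<Sum>l\<in>UNIV. complex_of_real (A $ k $ l) *\<^sub>P pd (VZ l) (pd (VZ k) p))
      + (\<Sum>k\<in>UNIV. \<Sum>l\<in>UNIV. complex_of_real (A $ k $ l) *\<^sub>P pd (VZ k) (pd (VZ l) p)))"
    by (simp add: Lap_z_def pd_VZ_so_act linear_pd[THEN lin_add] linear_pd[THEN lin_sum]
        linear_pd[THEN lin_scale] lin_sum[OF linear_vector_fields(6)] sum.distrib add.assoc)
  then show ?thesis
    using skew_symmetric_sum[OF assms, of "\<lambda>k l. pd (VZ k) (pd (VZ l) p)"]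
      skew_symmetric_sum[OF assms, of "\<lambda>k l. pd (VZ l) (pd (VZ k) p)"]
    by (simp add: pd_commute)
qed

lemma pd_norm2_z: "pd (VZ k) norm2_z = pz k + pz k"
proof -
  have "pd (VZ k) ((pz j)\<^sup>2) = (if k = j then pz k + pz k else 0)" for j
    by (simp add: power2_eq_square derivation_mult[OF derivation_pd] pd_Var)
  then show ?thesis
    by (simp add: norm2_z_def lin_sum[OF linear_pd])
qed

lemma vector_fields_norm2_z:
  "x_dy norm2_z = 0" "y_dx norm2_z = 0" "Euler_x norm2_z = 0" "Euler_y norm2_z = 0"
  "Euler_z norm2_z = 2 *\<^sub>P norm2_z"
  by (simp_all add: norm2_z_def power2_eq_square linear_vector_fields[THEN lin_sum]
      derivation_vector_fields[THEN derivation_mult] vector_fields_Var numeral_cscale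
      sum_distrib_left)

lemma so_act_norm2_z:
  assumes "transpose A = - A"
  shows "so_act A norm2_z = 0"
proof -
  have "so_act A norm2_z
      = (\<Sum>k\<in>UNIV. \<Sum>i\<in>UNIV. complex_of_real (A $ i $ k) *\<^sub>P (pz i * pz k))
      + (\<Sum>k\<in>UNIV. \<Sum>i\<in>UNIV. complex_of_real (A $ i $ k) *\<^sub>P (pz k * pz i))"
    by (simp add: norm2_z_def power2_eq_square lin_sum[OF linear_vector_fields(6)]
        derivation_mult[OF derivation_vector_fields(6)] so_act_Var sum_distrib_left
        sum_distrib_right cscale_mult_left cscale_mult_right sum.distrib)
  also have "\<dots> = 0"
    by (subst (1 2) sum.swap) (simp add: skew_symmetric_sum[OF assms] mult.commute)
  finally show ?thesis .
qed

lemma pd_numeral: "pd v (numeral n) = 0"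
  by (metis pd_const single_numeral)

text \<open>With the factors 1/2 of \<open>op_L\<close> and \<open>op_R\<close>, this relation
  supplies the terms \<open>Euler_z\<close> and m/2 of \<open>op_E\<close>.\<close>

lemma Lap_z_norm2_z:
  "Lap_z (norm2_z * p :: 'm::finite cpoly)
    = norm2_z * Lap_z p + 4 *\<^sub>P Euler_z p + (2 * of_nat CARD('m)) *\<^sub>P p"
proof -
  have "pd (VZ k) (pd (VZ k) (norm2_z * p))
      = norm2_z * pd (VZ k) (pd (VZ k) p) + 4 * (pz k * pd (VZ k) p) + 2 * p" for k
    by (simp add: derivation_mult[OF derivation_pd] pd_norm2_z lin_add[OF linear_pd] pd_Var
        pd_numeral algebra_simps)
  then have "Lap_z (norm2_z * p)
      = norm2_z * Lap_z p + 4 * Euler_z p + of_nat CARD('m) * (2 * p)"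
    by (simp add: Lap_z_def Euler_z_def sum.distrib flip: sum_distrib_left)
  then show ?thesis
    by (simp add: numeral_cscale of_nat_cscale algebra_simps flip: cpoly.scale_scale)
qed

section \<open>The commutation relations and the weight grading\<close>

lemmas cscale_algebra = cpoly.scale_right_distrib cpoly.scale_left_distrib
  cpoly.scale_right_diff_distrib cpoly.scale_left_diff_distrib

text \<open>The first-order parts contribute \<open>Euler_x - Euler_y\<close>, the parts in z
  contribute minus \<open>Euler_z\<close> minus m/2, and the mixed terms commute.\<close>

lemma op_L_op_R: "op_L (op_R p) = op_R (op_L p) - op_E p"
  for p :: "'m::finite cpoly"
proof -
  have "op_L (op_R p) = x_dy (y_dx p) + (1/2) *\<^sub>P (norm2_z * x_dy p)
      - (1/2) *\<^sub>P (Lap_z (y_dx p) + (1/2) *\<^sub>P Lap_z (norm2_z * p))"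
    by (simp add: op_L_eq op_R_eq linear_vector_fields(1)[THEN lin_add]
        linear_vector_fields(1)[THEN lin_scale] linear_Lap_z[THEN lin_add]
        linear_Lap_z[THEN lin_scale] derivation_mult[OF derivation_vector_fields(1)]
        vector_fields_norm2_z)
  also have "\<dots> = op_R (op_L p) - op_E p"
    by (simp add: op_L_eq op_R_eq op_E_def x_dy_y_dx Lap_z_derivations_commute Lap_z_norm2_z
        linear_vector_fields(2)[THEN lin_diff] linear_vector_fields(2)[THEN lin_scale]
        cscale_mult_right cscale_algebra right_diff_distrib)
  finally show ?thesis .
qed

lemma double_cscale: "2 *\<^sub>P p = p + p"
  using cpoly.scale_left_distrib[of 1 1 p] by simp

lemma op_E_op_R: "op_E (op_R p) = op_R (op_E p) + 2 *\<^sub>P op_R p"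
  by (simp add: op_E_def op_R_eq linear_vector_fields[THEN lin_add]
      linear_vector_fields[THEN lin_diff] linear_vector_fields[THEN lin_scale] Euler_x_dy_y_dx
      derivation_vector_fields[THEN derivation_mult] vector_fields_norm2_z cscale_algebra
      cscale_mult_left cscale_mult_right algebra_simps double_cscale[of "y_dx p"])

lemma op_E_op_L: "op_E (op_L p) = op_L (op_E p) - 2 *\<^sub>P op_L p"
  by (simp add: op_E_def op_L_eq linear_vector_fields[THEN lin_add]
      linear_vector_fields[THEN lin_diff] linear_vector_fields[THEN lin_scale]
      linear_Lap_z[THEN lin_add] linear_Lap_z[THEN lin_diff] linear_Lap_z[THEN lin_scale]
      Euler_x_dy_y_dx Lap_z_derivations_commute Lap_z_Euler_z cscale_algebra algebra_simps
      double_cscale[of "x_dy p"])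

text \<open>\<open>x_dy\<close> trades one y for one x and \<open>Lap_z\<close> touches neither.
  Together with its counterpart for \<open>op_R\<close> this shows that \<open>P1\<close> is
  preserved.\<close>

lemma total_degree_op_L: "Euler_x (op_L p) + Euler_y (op_L p) = op_L (Euler_x p + Euler_y p)"
  by (simp add: op_L_eq linear_vector_fields[THEN lin_add]
        linear_vector_fields[THEN lin_diff] linear_vector_fields[THEN lin_scale]
        linear_Lap_z[THEN lin_add] Euler_x_dy_y_dx Lap_z_derivations_commute cscale_algebra)

lemma total_degree_op_R: "Euler_x (op_R p) + Euler_y (op_R p) = op_R (Euler_x p + Euler_y p)"
  by (simp add: op_R_eq linear_vector_fields[THEN lin_add]
        linear_vector_fields[THEN lin_scale] derivation_vector_fields[THEN derivation_mult]
        vector_fields_norm2_z Euler_x_dy_y_dx cscale_algebra distrib_left)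

lemma so_act_op_E: "so_act A (op_E p) = op_E (so_act A p)"
  by (simp add: op_E_def linear_vector_fields[THEN lin_add] linear_vector_fields[THEN lin_diff]
        linear_vector_fields[THEN lin_scale] so_act_commute)

lemma so_act_op_L: "transpose A = - A \<Longrightarrow> so_act A (op_L p) = op_L (so_act A p)"
  by (simp add: op_L_eq linear_vector_fields[THEN lin_diff]
        linear_vector_fields[THEN lin_scale] so_act_commute Lap_z_so_act)

lemma so_act_op_R: "transpose A = - A \<Longrightarrow> so_act A (op_R p) = op_R (so_act A p)"
  by (simp add: op_R_eq linear_vector_fields[THEN lin_add]
        linear_vector_fields[THEN lin_scale] so_act_commute so_act_norm2_z
        derivation_mult[OF derivation_vector_fields(6)])

section \<open>Eigenvalue equations as degree conditions on monomials\<close>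

lemma lookup_Var_mult_pd:
  "Poly_Mapping.lookup (Var v * pd v p) t
    = of_nat (Poly_Mapping.lookup t v) * Poly_Mapping.lookup p t"
proof (induction p rule: cpoly_monomial_induct)
  case (single s c)
  have "Poly_Mapping.single v 1 + (s - Poly_Mapping.single v 1) = s"
    if "Poly_Mapping.lookup s v \<noteq> 0"
    by (rule poly_mapping_eqI)
       (use that in \<open>auto simp: lookup_add lookup_minus lookup_single when_def\<close>)
  then show ?case
    by (cases "Poly_Mapping.lookup s v = 0")
       (auto simp: pd_single Var_mult_single lookup_single when_def)
qed (simp add: lin_add[OF linear_pd] lookup_add algebra_simps)

text \<open>Monomials are eigenvectors of the Euler operators, so membership in \<open>P1\<close>,
  \<open>weight_space\<close> and \<open>harm_z\<close> can be expressed both by operator equations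
  and by degrees.\<close>

lemma lookup_Euler:
  "Poly_Mapping.lookup (Euler_x p) t = of_nat (deg_x t) * Poly_Mapping.lookup p t"
  "Poly_Mapping.lookup (Euler_y p) t = of_nat (deg_y t) * Poly_Mapping.lookup p t"
  "Poly_Mapping.lookup (Euler_z p) t = of_nat (deg_z t) * Poly_Mapping.lookup p t"
  by (simp_all add: Euler_x_def Euler_y_def Euler_z_def lookup_sum lookup_Var_mult_pd
      deg_x_def deg_y_def deg_z_def sum_distrib_right)

lemma lookup_op_E:
  "Poly_Mapping.lookup (op_E p) t
    = (of_nat (deg_y t) - of_nat (deg_x t) + of_nat (deg_z t) + of_nat CARD('m) / 2)
      * Poly_Mapping.lookup p t"
  for p :: "'m::finite cpoly"
  by (simp add: op_E_def lookup_add lookup_minus lookup_Euler lookup_cscale algebra_simps)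

lemma P1_iff: "p \<in> P1 \<longleftrightarrow> Euler_x p + Euler_y p = p"
proof -
  have "(\<forall>t. Poly_Mapping.lookup (Euler_x p + Euler_y p) t = Poly_Mapping.lookup p t) \<longleftrightarrow> p \<in> P1"
    by (simp add: P1_def lookup_add lookup_Euler in_keys_iff flip: distrib_right of_nat_add)
       (metis in_keys_iff)
  then show ?thesis by (metis poly_mapping_eqI)
qed

definition weight :: "'m::finite itself \<Rightarrow> nat \<Rightarrow> complex" where
  "weight _ a = of_nat a - 1 + of_nat CARD('m) / 2"

text \<open>
  The eigenvalue \<open>a - 1 + m/2\<close> of \<^const>\<open>op_E\<close> singles out the monomials of \<^const>\<open>P1\<close> with
  \<open>2 deg\<^sub>y + deg\<^sub>z = a\<close>, because \<open>deg\<^sub>y - deg\<^sub>x = 2 deg\<^sub>y - 1\<close> there.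
\<close>

definition weight_space :: "nat \<Rightarrow> 'm::finite cpoly set" where
  "weight_space a = {p \<in> P1. op_E p = weight TYPE('m) a *\<^sub>P p}"

lemma weight_space_iff:
  "p \<in> weight_space a
    \<longleftrightarrow> (\<forall>t\<in>Poly_Mapping.keys p. deg_x t + deg_y t = 1 \<and> 2 * deg_y t + deg_z t = a)"
proof -
  have "op_E p = c *\<^sub>P p \<longleftrightarrow> (\<forall>t\<in>Poly_Mapping.keys p.
      of_nat (deg_y t) - of_nat (deg_x t) + of_nat (deg_z t) + of_nat CARD('a) / 2 = c)" for c
    unfolding poly_mapping_eq_iff fun_eq_iff lookup_op_E lookup_cscale
    by (auto simp: in_keys_iff)
  moreover have "complex_of_nat y - of_nat x + of_nat z + d = of_nat a - 1 + d \<longleftrightarrow> 2 * y + z = a"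
    if "x + y = 1" for x y z d
  proof -
    have "complex_of_nat x = 1 - of_nat y"
      using that by (metis add_diff_cancel_right' of_nat_1 of_nat_add)
    then have "(complex_of_nat y - of_nat x + of_nat z + d) - (of_nat a - 1 + d)
        = of_nat (2 * y + z) - complex_of_nat a"
      by simp
    then show ?thesis by (metis eq_iff_diff_eq_0 of_nat_eq_iff)
  qed
  ultimately show ?thesis
    by (auto simp: weight_space_def weight_def P1_def)
qed

lemma harm_z_iff:
  "p \<in> harm_z a \<longleftrightarrow> Euler_x p = 0 \<and> Euler_y p = 0 \<and> Euler_z p = of_nat a *\<^sub>P p \<and> Lap_z p = 0"
  unfolding harm_z_def poly_mapping_eq_iff fun_eq_iff lookup_Euler lookup_cscale
  by (auto simp: in_keys_iff)

section \<open>Weight spaces, singular vectors and their invariance\<close>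

lemma linear_compose:
  "cpoly_linear S \<Longrightarrow> cpoly_linear T \<Longrightarrow> cpoly_linear (\<lambda>p. S (T p))"
  by (rule cpoly_linearI) (simp_all add: lin_add lin_scale)

lemma linear_plus:
  "cpoly_linear S \<Longrightarrow> cpoly_linear T \<Longrightarrow> cpoly_linear (\<lambda>p. S p + T p)"
  by (rule cpoly_linearI) (simp_all add: lin_add lin_scale cscale_algebra)

lemma linear_cscale: "cpoly_linear T \<Longrightarrow> cpoly_linear (\<lambda>p. c *\<^sub>P T p)"
  by (rule cpoly_linearI) (simp_all add: lin_add lin_scale cscale_algebra cpoly.scale_left_commute)

lemma linear_power: "cpoly_linear T \<Longrightarrow> cpoly_linear (T ^^ j)"
proof (induction j)
  case 0
  then show ?case by (simp add: cpoly_linearI)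
next
  case (Suc j)
  then show ?case using linear_compose[of T "T ^^ j"] by (simp add: comp_def)
qed

lemma subspace_eigenspace:
  assumes "cpoly_linear T"
  shows "cpoly_subspace {p. T p = c *\<^sub>P p}"
  unfolding cpoly.subspace_def
  by (auto simp: lin_add[OF assms] lin_zero[OF assms] lin_scale[OF assms] cpoly.scale_right_distrib
      cpoly.scale_left_commute)

lemma subspace_kernel:
  assumes "cpoly_linear T"
  shows "cpoly_subspace {p. T p = 0}"
  using subspace_eigenspace[OF assms, of 0] by simp

lemma subspace_P1: "cpoly_subspace P1"
  using subspace_eigenspace[OF linear_plus[OF linear_vector_fields(3,4)], of 1]
  by (simp flip: P1_iff)

lemma so_submodule_P1: "so_submodule P1"
  unfolding so_submodule_def
proof (intro conjI allI impI ballI subspace_P1)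
  fix A p assume "p \<in> P1"
  then have "so_act A (Euler_x p + Euler_y p) = so_act A p" by (simp add: P1_iff)
  then show "so_act A p \<in> P1"
    by (simp add: P1_iff lin_add[OF linear_vector_fields(6)] so_act_commute)
qed

lemma subspace_weight_space: "cpoly_subspace (weight_space a :: 'm::finite cpoly set)"
  using cpoly.subspace_inter[OF subspace_P1 subspace_eigenspace[OF linear_op_E]]
  by (simp add: weight_space_def Int_def conj_commute)

definition singular :: "nat \<Rightarrow> 'm::finite cpoly set" where
  "singular a = {p \<in> weight_space a. op_L p = 0}"

lemma subspace_singular: "cpoly_subspace (singular a)"
  using cpoly.subspace_inter[OF subspace_weight_space subspace_kernel[OF linear_op_L]]
  by (simp add: singular_def Int_def conj_commute)

lemma so_act_P1: "transpose A = - A \<Longrightarrow> p \<in> P1 \<Longrightarrow> so_act A p \<in> P1"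
  using so_submodule_P1 unfolding so_submodule_def by blast

lemma so_act_weight_space:
  "transpose A = - A \<Longrightarrow> p \<in> weight_space a \<Longrightarrow> so_act A p \<in> weight_space a"
  by (simp add: weight_space_def so_act_P1 lin_scale[OF linear_vector_fields(6)] flip: so_act_op_E)

lemma so_submodule_singular: "so_submodule (singular a)"
  unfolding so_submodule_def
  by (rule conjI[OF subspace_singular]) (auto simp: singular_def so_act_weight_space
      lin_zero[OF linear_vector_fields(6)] simp flip: so_act_op_L)

lemma weight_add: "weight TYPE('m::finite) (a + n) = weight TYPE('m) a + of_nat n"
  by (simp add: weight_def)

lemma op_R_weight_space: "p \<in> weight_space a \<Longrightarrow> op_R p \<in> weight_space (a + 2)"
  by (simp add: weight_space_def P1_iff total_degree_op_R op_E_op_R lin_scale[OF linear_op_R]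
      weight_add cpoly.scale_left_distrib del: add_2_eq_Suc')

lemma op_R_power_weight_space: "p \<in> weight_space a \<Longrightarrow> (op_R ^^ j) p \<in> weight_space (a + 2 * j)"
  by (induction j) (auto dest: op_R_weight_space)

lemma op_L_P1: "p \<in> P1 \<Longrightarrow> op_L p \<in> P1"
  by (simp add: P1_iff total_degree_op_L)

lemma op_E_op_L_weight_space:
  fixes p :: "'m::finite cpoly"
  assumes "p \<in> weight_space a"
  shows "op_E (op_L p) = (weight TYPE('m) a - 2) *\<^sub>P op_L p"
  using assms by (simp add: weight_space_def op_E_op_L lin_scale[OF linear_op_L] cscale_algebra)

lemma op_L_weight_space: "p \<in> weight_space (a + 2) \<Longrightarrow> op_L p \<in> weight_space a"
  using op_E_op_L_weight_space[of p "a + 2"] op_L_P1[of p]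
  by (simp add: weight_space_def weight_def)

text \<open>The image would have weight index \<open>a - 2 < 0\<close>, whereas every monomial of
  \<open>P1\<close> has index at least 0. This starts the induction on the weight.\<close>

lemma op_L_weight_space_lt_2:
  fixes p :: "'m::finite cpoly"
  assumes "p \<in> weight_space a" "a < 2"
  shows "op_L p = 0"
proof -
  have P1: "op_L p \<in> P1" using assms op_L_P1 by (auto simp: weight_space_def)
  have "t \<notin> Poly_Mapping.keys (op_L p)" for t
  proof
    assume t: "t \<in> Poly_Mapping.keys (op_L p)"
    with P1 have deg: "deg_x t + deg_y t = 1" by (auto simp: P1_def)
    have "(of_nat (deg_y t) - of_nat (deg_x t) + of_nat (deg_z t) + of_nat CARD('m) / 2)
        = weight TYPE('m) a - 2"
      using arg_cong[OF op_E_op_L_weight_space[OF assms(1)], of "\<lambda>q. Poly_Mapping.lookup q t"] t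
      by (simp add: lookup_op_E lookup_cscale in_keys_iff)
    \<comment> \<open>Moving negative terms across makes both sides natural numbers. The right one
      is at most 2, because \<open>deg_x t\<close> and \<open>a\<close> are at most 1.\<close>
    then have "complex_of_nat (deg_y t + deg_z t + 3) = of_nat (a + deg_x t)"
      by (simp add: weight_def algebra_simps)
    then have "deg_y t + deg_z t + 3 = a + deg_x t" by (simp only: of_nat_eq_iff)
    with deg assms(2) show False by linarith
  qed
  then show ?thesis by (metis equals0I keys_eq_empty)
qed

text \<open>Moving \<open>op_L\<close> to the right through the powers of \<open>op_R\<close>
  collects minus the weights w, w + 2, ..., w + 2j, whose sum is (j + 1)(w + j).\<close>

lemma op_L_op_R_power:
  fixes p :: "'m::finite cpoly"
  assumes p: "p \<in> singular a"
  shows "op_L ((op_R ^^ Suc j) p)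
    = (- (of_nat (Suc j) * (weight TYPE('m) a + of_nat j))) *\<^sub>P (op_R ^^ j) p"
proof (induction j)
  case 0
  then show ?case
    using p by (simp add: op_L_op_R singular_def weight_space_def lin_zero[OF linear_op_R])
next
  case (Suc j)
  let ?w = "weight TYPE('m) a"
  have "(op_R ^^ Suc j) p \<in> weight_space (a + 2 * Suc j)"
    using p by (intro op_R_power_weight_space) (simp add: singular_def)
  then have E: "op_E ((op_R ^^ Suc j) p) = (?w + 2 * of_nat (Suc j)) *\<^sub>P (op_R ^^ Suc j) p"
    by (simp add: weight_space_def weight_def algebra_simps)
  have "op_L ((op_R ^^ Suc (Suc j)) p)
      = op_R (op_L ((op_R ^^ Suc j) p)) - op_E ((op_R ^^ Suc j) p)"
    using op_L_op_R[of "(op_R ^^ Suc j) p"] by simp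
  also have "\<dots> = (- (of_nat (Suc j) * (?w + of_nat j)) - (?w + 2 * of_nat (Suc j)))
      *\<^sub>P (op_R ^^ Suc j) p"
    unfolding Suc.IH E by (simp only: lin_scale[OF linear_op_R] cpoly.scale_left_diff_distrib funpow.simps o_apply)
  also have "\<dots> = (- (of_nat (Suc (Suc j)) * (?w + of_nat (Suc j)))) *\<^sub>P (op_R ^^ Suc j) p"
    by (rule arg_cong[where f = "\<lambda>c. c *\<^sub>P _"]) (simp add: algebra_simps)
  finally show ?case .
qed

text \<open>Applying \<open>T - e a\<close> to the vanishing sum removes the summand at
  \<open>a\<close> and multiplies the others by nonzero scalars, so induction on the index set
  applies.\<close>

lemma sum_eigenvectors_zero:
  assumes T: "cpoly_linear T" and "finite I" "inj_on e I"
    and "\<And>i. i \<in> I \<Longrightarrow> T (f i) = e i *\<^sub>P f i" "(\<Sum>i\<in>I. f i) = 0" "i \<in> I"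
  shows "f i = 0"
  using assms(2-)
proof (induction I arbitrary: f i rule: finite_induct)
  case (insert a I)
  have "f j = 0" if "j \<in> I" for j
  proof -
    have "(\<Sum>i\<in>insert a I. e i *\<^sub>P f i) = T (\<Sum>i\<in>insert a I. f i)"
      by (simp only: lin_sum[OF T]) (rule sum.cong, simp_all add: insert.prems(2))
    also have "\<dots> = 0" by (simp only: insert.prems(3) lin_zero[OF T])
    finally have "(\<Sum>i\<in>insert a I. (e i - e a) *\<^sub>P f i) = e a *\<^sub>P - (\<Sum>i\<in>insert a I. f i)"
      by (simp only: cpoly.scale_left_diff_distrib sum_subtractf cpoly.scale_sum_right)
         (simp add: sum_negf cpoly.scale_sum_right)
    then have "(\<Sum>i\<in>I. (e i - e a) *\<^sub>P f i) = 0"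
      using insert.hyps insert.prems(3) by simp
    moreover have "T ((e i - e a) *\<^sub>P f i) = e i *\<^sub>P (e i - e a) *\<^sub>P f i" if "i \<in> I" for i
      using that insert.prems(2) by (simp add: lin_scale[OF T] cpoly.scale_left_commute)
    ultimately have "(e j - e a) *\<^sub>P f j = 0"
      using insert.prems(1) that by (intro insert.IH[of "\<lambda>i. (e i - e a) *\<^sub>P f i" j]) (auto simp: inj_on_def)
    moreover have "e j \<noteq> e a"
      using insert.prems(1) insert.hyps that by (auto simp: inj_on_def)
    ultimately show ?thesis by simp
  qed
  then show ?case using insert.prems(3,4) insert.hyps by (auto simp: sum.neutral)
qed simp

lemma sum_support_eq:
  assumes "finite A" "\<And>i. f i \<noteq> 0 \<Longrightarrow> i \<in> A"
  shows "(\<Sum>i | f i \<noteq> 0. f i) = (\<Sum>i\<in>A. f i)"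
  by (rule sum.mono_neutral_left) (use assms in auto)

text \<open>The summation map is linear on \<open>ext_sum I W\<close>. Injectivity therefore reduces
  to a trivial kernel, and its image is a subspace lying between the summands and their
  span.\<close>

lemma so_direct_sumI:
  assumes V: "so_submodule V" "\<And>i. i \<in> I \<Longrightarrow> so_submodule (W i)"
    and indep: "\<And>f i. f \<in> ext_sum I W \<Longrightarrow> (\<Sum>i | f i \<noteq> 0. f i) = 0 \<Longrightarrow> f i = 0"
    and span: "V = cpoly_span (\<Union>i\<in>I. W i)"
  shows "so_direct_sum V I W"
proof -
  let ?S = "\<lambda>f. \<Sum>i | f i \<noteq> 0. f i"
  have sub: "cpoly_subspace (W i)" if "i \<in> I" for i
    using V(2)[OF that] by (simp add: so_submodule_def)
  have lin: "(\<lambda>i. c *\<^sub>P f i + d *\<^sub>P g i) \<in> ext_sum I W \<and>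
      ?S (\<lambda>i. c *\<^sub>P f i + d *\<^sub>P g i) = c *\<^sub>P ?S f + d *\<^sub>P ?S g"
    if f: "f \<in> ext_sum I W" and g: "g \<in> ext_sum I W" for f g c d
  proof
    \<comment> \<open>The supports of \<open>f\<close>, \<open>g\<close> and their combination
      differ; all three sums are taken over the common finite set \<open>?A\<close>.\<close>
    let ?h = "\<lambda>i. c *\<^sub>P f i + d *\<^sub>P g i" and ?A = "{i. f i \<noteq> 0} \<union> {i. g i \<noteq> 0}"
    have A: "finite ?A" using f g by (simp add: ext_sum_def)
    then have "finite {i. ?h i \<noteq> 0}" by (rule rev_finite_subset) auto
    moreover have "?h i \<in> W i" if "i \<in> I" for i
      using f g that sub[OF that] by (auto simp: ext_sum_def intro!: cpoly.subspace_add cpoly.subspace_scale)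
    ultimately show "?h \<in> ext_sum I W"
      using f g by (auto simp: ext_sum_def)
    have "?S ?h = sum ?h ?A" "?S f = sum f ?A" "?S g = sum g ?A"
      by (rule sum_support_eq[OF A]; auto)+
    then show "?S ?h = c *\<^sub>P ?S f + d *\<^sub>P ?S g"
      by (simp add: sum.distrib cpoly.scale_sum_right)
  qed
  have "inj_on ?S (ext_sum I W)"
  proof (rule inj_onI, rule ext)
    fix f g i assume *: "f \<in> ext_sum I W" "g \<in> ext_sum I W" "?S f = ?S g"
    have "1 *\<^sub>P f i + (-1) *\<^sub>P g i = 0"
      using lin[OF *(1,2), of 1 "-1"] *(3) by (intro indep[of "\<lambda>i. 1 *\<^sub>P f i + (-1) *\<^sub>P g i"]) auto
    then show "f i = g i" by simp
  qed
  moreover have "?S ` ext_sum I W = V"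
  proof
    show "?S ` ext_sum I W \<subseteq> V"
    proof (clarify, unfold span, rule cpoly.span_sum)
      fix f i assume "f \<in> ext_sum I W" "i \<in> {i. f i \<noteq> 0}"
      then have "i \<in> I" "f i \<in> W i" by (auto simp: ext_sum_def)
      then show "f i \<in> cpoly_span (\<Union>i\<in>I. W i)" by (blast intro: cpoly.span_base)
    qed
    have "(\<lambda>i. 0) \<in> ext_sum I W"
      using sub by (auto simp: ext_sum_def intro: cpoly.subspace_0)
    then have "0 \<in> ?S ` ext_sum I W" by (intro image_eqI[of _ _ "\<lambda>i. 0"]) simp_all
    moreover have "?S f + ?S g \<in> ?S ` ext_sum I W"
      if "f \<in> ext_sum I W" "g \<in> ext_sum I W" for f g
      using lin[OF that, of 1 1] by (intro image_eqI[of _ _ "\<lambda>i. 1 *\<^sub>P f i + 1 *\<^sub>P g i"]) simp_all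
    moreover have "c *\<^sub>P ?S f \<in> ?S ` ext_sum I W" if "f \<in> ext_sum I W" for c f
      using lin[OF that that, of c 0] by (intro image_eqI[of _ _ "\<lambda>i. c *\<^sub>P f i + 0 *\<^sub>P f i"]) simp_all
    ultimately have "cpoly_subspace (?S ` ext_sum I W)"
      unfolding cpoly.subspace_def by blast
    moreover have "p \<in> ?S ` ext_sum I W" if "i \<in> I" "p \<in> W i" for p i
    proof
      let ?f = "\<lambda>j. if j = i then p else 0"
      have "finite {j. ?f j \<noteq> 0}" by (rule finite_subset[of _ "{i}"]) auto
      then show "?f \<in> ext_sum I W"
        using that sub by (auto simp: ext_sum_def intro: cpoly.subspace_0)
      show "p = ?S ?f" by (subst sum_support_eq[of "{i}"]) (auto split: if_splits)
    qed
    ultimately show "V \<subseteq> ?S ` ext_sum I W"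
      unfolding span by (intro cpoly.span_minimal) auto
  qed
  ultimately show ?thesis
    using V by (simp add: so_direct_sum_def bij_betw_def)
qed

section \<open>Decomposition into singular vectors\<close>

text \<open>The real part is at least m/2 - 1, which is positive for m \<ge> 3.\<close>

lemma weight_plus_nonzero:
  assumes "CARD('m::finite) \<ge> 3"
  shows "weight TYPE('m) a + of_nat j \<noteq> 0"
proof
  assume "weight TYPE('m) a + of_nat j = 0"
  then have "Re (weight TYPE('m) a + of_nat j) = 0" by simp
  then have "real a - 1 + real CARD('m) / 2 + real j = 0" by (simp add: weight_def)
  then show False using assms by linarith
qed

section \<open>Towers generated by \<open>op_R\<close> from singular vectors\<close>

lemma op_R_power_P1: "p \<in> singular a \<Longrightarrow> (op_R ^^ j) p \<in> P1"
  using op_R_power_weight_space[of p a j] by (simp add: singular_def weight_space_def)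

lemmas linear_subspace_vimage = module_hom.subspace_vimage[of cscale cscale, folded cpoly_subspace_def]
lemmas linear_subspace_image = module_hom.subspace_image[of cscale cscale, folded cpoly_subspace_def]

text \<open>All generators have the same weight index \<open>b\<close>, so the spanning claim can be
  proved by induction on \<open>b\<close>.\<close>

definition tower :: "nat \<Rightarrow> 'm::finite cpoly set" where
  "tower b = cpoly_span {(op_R ^^ j) p |j a p. p \<in> singular a \<and> a + 2 * j = b}"

lemma tower_base: "p \<in> singular a \<Longrightarrow> (op_R ^^ j) p \<in> tower (a + 2 * j)"
  unfolding tower_def by (rule cpoly.span_base) blast

lemma tower_minimal:
  assumes "cpoly_subspace S" "\<And>j a p. p \<in> singular a \<Longrightarrow> a + 2 * j = b \<Longrightarrow> (op_R ^^ j) p \<in> S"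
  shows "tower b \<subseteq> S"
  unfolding tower_def by (rule cpoly.span_minimal[OF _ assms(1)]) (auto intro: assms(2))

lemma subspace_tower: "cpoly_subspace (tower b)"
  by (simp add: tower_def cpoly.subspace_span)

lemma op_R_tower: "p \<in> tower b \<Longrightarrow> op_R p \<in> tower (b + 2)"
proof -
  have "tower b \<subseteq> op_R -` tower (b + 2)"
  proof (rule tower_minimal)
    fix j a p assume "p \<in> singular a" "a + 2 * j = b"
    then show "(op_R ^^ j) p \<in> op_R -` tower (b + 2)"
      using tower_base[of p a "Suc j"] by auto
  qed (rule linear_subspace_vimage[OF linear_op_R subspace_tower])
  then show "p \<in> tower b \<Longrightarrow> op_R p \<in> tower (b + 2)" by blast
qed

text \<open>Each generator is an eigenvector of the composition with a nonzero eigenvalue, so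
  dividing by the eigenvalue gives a preimage.\<close>

lemma op_L_op_R_tower_surj:
  fixes p :: "'m::finite cpoly"
  assumes "CARD('m) \<ge> 3" "p \<in> tower b"
  shows "\<exists>q\<in>tower b. op_L (op_R q) = p"
proof -
  have "tower b \<subseteq> (\<lambda>q. op_L (op_R q)) ` (tower b :: 'm cpoly set)"
  proof (rule tower_minimal)
    fix j a and p :: "'m cpoly" assume p: "p \<in> singular a" and j: "a + 2 * j = b"
    define c where "c = - (of_nat (Suc j) * (weight TYPE('m) a + of_nat j))"
    have "c \<noteq> 0"
      using weight_plus_nonzero[OF assms(1), of a j] by (simp add: c_def del: of_nat_Suc)
    moreover have "op_L (op_R ((op_R ^^ j) p)) = c *\<^sub>P (op_R ^^ j) p"
      using op_L_op_R_power[OF p, of j] by (simp add: c_def)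
    ultimately have "op_L (op_R (inverse c *\<^sub>P (op_R ^^ j) p)) = (op_R ^^ j) p"
      by (simp add: lin_scale[OF linear_op_R] lin_scale[OF linear_op_L])
    moreover have "inverse c *\<^sub>P (op_R ^^ j) p \<in> tower b"
      using tower_base[OF p, of j] j by (intro cpoly.subspace_scale subspace_tower) simp
    ultimately show "(op_R ^^ j) p \<in> (\<lambda>q. op_L (op_R q)) ` tower b"
      by (metis imageI)
  qed (rule linear_subspace_image[OF linear_compose[OF linear_op_L linear_op_R] subspace_tower])
  with assms(2) show ?thesis by blast
qed

lemma weight_space_subset_tower:
  assumes "CARD('m::finite) \<ge> 3"
  shows "weight_space b \<subseteq> (tower b :: 'm cpoly set)"
proof (induction b rule: less_induct)
  case (less b)
  show ?case
  proof
    fix p :: "'m cpoly" assume p: "p \<in> weight_space b"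
    show "p \<in> tower b"
    proof (cases "b < 2")
      case True
      then show ?thesis
        using tower_base[of p b 0] p by (simp add: singular_def op_L_weight_space_lt_2)
    next
      case False
      then obtain c where b: "b = c + 2" by (metis add.commute le_Suc_ex not_less)
      have "op_L p \<in> tower c"
        using less.IH[of c] op_L_weight_space[of p c] p b by auto
      \<comment> \<open>This choice of \<open>q\<close> makes \<open>p - op_R q\<close>
        singular.\<close>
      then obtain q where q: "q \<in> tower c" "op_L (op_R q) = op_L p"
        using op_L_op_R_tower_surj[OF assms] by blast
      have "tower b \<subseteq> (weight_space b :: 'm cpoly set)"
        by (rule tower_minimal[OF subspace_weight_space])
           (use op_R_power_weight_space in \<open>auto simp: singular_def\<close>)
      then have "op_R q \<in> weight_space b"
        using op_R_tower[OF q(1)] b by blast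
      then have "p - op_R q \<in> weight_space b"
        by (rule cpoly.subspace_diff[OF subspace_weight_space p])
      then have "p - op_R q \<in> singular b"
        using q(2) by (simp add: singular_def lin_diff[OF linear_op_L])
      then have "p - op_R q \<in> tower b" using tower_base[of _ b 0] by simp
      then have "(p - op_R q) + op_R q \<in> tower b"
        using op_R_tower[OF q(1)] b by (intro cpoly.subspace_add subspace_tower) auto
      then show ?thesis by simp
    qed
  qed
qed

text \<open>A monomial of \<open>P1\<close> is itself a weight vector, so splitting \<open>p\<close>
  into monomials reduces the claim to single weight spaces.\<close>

lemma P1_subset_span:
  assumes "CARD('m::finite) \<ge> 3"
  shows "P1 \<subseteq> cpoly_span {(op_R ^^ j) p |j a p. p \<in> (singular a :: 'm cpoly set)}"
proof
  fix p :: "'m cpoly" assume p: "p \<in> P1"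
  let ?S = "{(op_R ^^ j) p |j a p. p \<in> (singular a :: 'm cpoly set)}"
  have "Poly_Mapping.single t (Poly_Mapping.lookup p t) \<in> cpoly_span ?S"
    if "t \<in> Poly_Mapping.keys p" for t
  proof -
    let ?b = "2 * deg_y t + deg_z t"
    have "Poly_Mapping.single t (Poly_Mapping.lookup p t) \<in> weight_space ?b"
      using p that by (auto simp: weight_space_iff P1_def)
    then have "Poly_Mapping.single t (Poly_Mapping.lookup p t) \<in> tower ?b"
      using weight_space_subset_tower[OF assms] by blast
    moreover have "tower ?b \<subseteq> cpoly_span ?S"
      unfolding tower_def by (rule cpoly.span_mono) auto
    ultimately show ?thesis by blast
  qed
  then have "(\<Sum>t\<in>Poly_Mapping.keys p. Poly_Mapping.single t (Poly_Mapping.lookup p t)) \<in> cpoly_span ?S"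
    by (rule cpoly.span_sum)
  then show "p \<in> cpoly_span ?S" by (simp flip: sum_single_lookup)
qed

text \<open>
  The Casimir operator \<open>\<E>\<^sup>2 - 2\<E> + 4RL\<close> plus \<open>\<i>\<E>\<close>: on \<open>R\<^sup>j\<close> of a singular vector of weight
  \<open>\<lambda>\<close> these have the real eigenvalues \<open>\<lambda>\<^sup>2 - 2\<lambda>\<close> and \<open>\<lambda> + 2j\<close>, so that one complex eigenvalue
  determines both \<open>\<lambda>\<close> and \<open>j\<close>.
\<close>

definition casimir_E :: "'m::finite cpoly \<Rightarrow> 'm cpoly" where
  "casimir_E p = op_E (op_E p) + ((\<i> - 2) *\<^sub>P op_E p + 4 *\<^sub>P op_R (op_L p))"

definition casimir_E_eigenvalue :: "'m::finite itself \<Rightarrow> nat \<times> nat \<Rightarrow> complex" where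
  "casimir_E_eigenvalue T = (\<lambda>(j, a).
     weight T a * (weight T a - 2) + \<i> * (weight T a + 2 * of_nat j))"

lemma linear_casimir_E: "cpoly_linear casimir_E"
  unfolding casimir_E_def
  by (rule linear_plus[OF linear_compose[OF linear_op_E linear_op_E] linear_plus[OF
      linear_cscale[OF linear_op_E] linear_cscale[OF linear_compose[OF linear_op_R linear_op_L]]]])

lemma casimir_E_op_R_power:
  fixes p :: "'m::finite cpoly"
  assumes "p \<in> singular a"
  shows "casimir_E ((op_R ^^ j) p) = casimir_E_eigenvalue TYPE('m) (j, a) *\<^sub>P (op_R ^^ j) p"
proof -
  let ?w = "weight TYPE('m) a" and ?q = "(op_R ^^ j) p"
  have E: "op_E ?q = (?w + 2 * of_nat j) *\<^sub>P ?q"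
    using op_R_power_weight_space[of p a j] assms
    by (simp add: singular_def weight_space_def weight_add)
  \<comment> \<open>This is \<open>op_L_op_R_power\<close> with the exponent shifted by one,
    extended to \<open>j = 0\<close>, where both sides vanish.\<close>
  have RL: "op_R (op_L ?q) = (- (of_nat j * (?w + of_nat j - 1))) *\<^sub>P ?q"
  proof (cases j)
    case 0
    then show ?thesis using assms by (simp add: singular_def lin_zero[OF linear_op_R])
  next
    case (Suc i)
    then have "?w + of_nat j - 1 = ?w + of_nat i" by simp
    then show ?thesis
      by (simp only: Suc op_L_op_R_power[OF assms, unfolded funpow.simps o_apply] lin_scale[OF linear_op_R] funpow.simps o_apply)
  qed
  \<comment> \<open>With c = \<i> all dependence on \<open>j\<close> cancels from the real part and
    survives only in the imaginary part.\<close>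
  have eq: "(w + 2 * n) * (w + 2 * n) + ((c - 2) * (w + 2 * n) + 4 * - (n * (w + n - 1)))
      = w * (w - 2) + c * (w + 2 * n)" for w n c :: complex
    by algebra
  have "casimir_E ?q = ((?w + 2 * of_nat j) * (?w + 2 * of_nat j)
      + ((\<i> - 2) * (?w + 2 * of_nat j) + 4 * - (of_nat j * (?w + of_nat j - 1)))) *\<^sub>P ?q"
    unfolding casimir_E_def E RL lin_scale[OF linear_op_E] cpoly.scale_scale
    by (simp only: cpoly.scale_left_distrib)
  then show ?thesis
    by (simp only: eq casimir_E_eigenvalue_def prod.case)
qed

text \<open>The real part determines \<lambda> up to the reflection sending \<lambda> to 2 -
  \<lambda>. The reflected case means a + a' + m = 4, which for m \<ge> 4 leaves only a = a' = 0.
  The imaginary part then yields \<open>j\<close>.\<close>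

lemma inj_casimir_E_eigenvalue:
  assumes "CARD('m::finite) \<ge> 4"
  shows "inj (casimir_E_eigenvalue TYPE('m))"
proof (rule injI, clarify)
  fix j a j' a' assume eq: "casimir_E_eigenvalue TYPE('m) (j, a) = casimir_E_eigenvalue TYPE('m) (j', a')"
  define l where "l a = real a - 1 + real CARD('m) / 2" for a
  have w: "weight TYPE('m) a = of_real (l a)" for a by (simp add: weight_def l_def)
  have Re: "Re (casimir_E_eigenvalue TYPE('m) (j, a)) = l a * (l a - 2)"
    and Im: "Im (casimir_E_eigenvalue TYPE('m) (j, a)) = l a + 2 * real j" for a j
    by (simp_all add: casimir_E_eigenvalue_def w)
  have Re_eq: "l a * (l a - 2) = l a' * (l a' - 2)"
    using arg_cong[OF eq, of Re] by (simp only: Re)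
  have Im_eq: "l a + 2 * real j = l a' + 2 * real j'"
    using arg_cong[OF eq, of Im] by (simp only: Im)
  have "(l a - l a') * (l a + l a' - 2) = l a * (l a - 2) - l a' * (l a' - 2)"
    by (simp add: algebra_simps)
  then have "l a = l a' \<or> l a + l a' - 2 = 0" by (simp only: Re_eq diff_self mult_eq_0_iff right_minus_eq)
  then have "a = a'"
  proof
    assume "l a + l a' - 2 = 0"
    then have "real (a + a' + CARD('m)) = real 4" by (simp add: l_def)
    then have "a + a' + CARD('m) = 4" by (simp only: of_nat_eq_iff)
    with assms show ?thesis by linarith
  qed (simp add: l_def)
  with Im_eq show "j = j' \<and> a = a'" by simp
qed

lemma op_R_power_singular_independent:
  fixes f :: "nat \<times> nat \<Rightarrow> 'm::finite cpoly"
  assumes "CARD('m) \<ge> 4" "finite I" "\<And>j a. (j, a) \<in> I \<Longrightarrow> f (j, a) \<in> (op_R ^^ j) ` singular a"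
    and "(\<Sum>i\<in>I. f i) = 0" "i \<in> I"
  shows "f i = 0"
proof (rule sum_eigenvectors_zero[OF linear_casimir_E assms(2) _ _ assms(4,5)])
  show "inj_on (casimir_E_eigenvalue TYPE('m)) I"
    using inj_casimir_E_eigenvalue[OF assms(1)] by (rule inj_on_subset) simp
  fix i assume i: "i \<in> I"
  obtain j a where ja: "i = (j, a)" by (cases i)
  then obtain p where p: "p \<in> singular a" "f i = (op_R ^^ j) p"
    using assms(3) i by blast
  show "casimir_E (f i) = casimir_E_eigenvalue TYPE('m) i *\<^sub>P f i"
    unfolding p(2) unfolding ja by (rule casimir_E_op_R_power[OF p(1)])
qed

section \<open>Singular vectors as products with harmonic polynomials\<close>

text \<open>Differentiating in a y-variable reads only coefficients at monomials of positive
  y-degree; these vanish if \<open>Euler_y p = 0\<close>. The same holds for x.\<close>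

lemma pd_VY_eq_0: "Euler_y p = 0 \<Longrightarrow> pd (VY k) p = 0"
  and pd_VX_eq_0: "Euler_x p = 0 \<Longrightarrow> pd (VX k) p = 0"
  for p :: "'m::finite cpoly"
proof -
  have "Poly_Mapping.lookup p (t + Poly_Mapping.single (VY k) 1) = 0" if "Euler_y p = 0" for t
  proof -
    have "deg_y (t + Poly_Mapping.single (VY k) 1) > 0"
      unfolding deg_y_def by (rule sum_pos2[of _ k]) (simp_all add: lookup_add)
    moreover have "of_nat (deg_y (t + Poly_Mapping.single (VY k) 1))
        * Poly_Mapping.lookup p (t + Poly_Mapping.single (VY k) 1) = 0"
      using that by (simp flip: lookup_Euler(2))
    ultimately show ?thesis by simp
  qed
  then show "Euler_y p = 0 \<Longrightarrow> pd (VY k) p = 0"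
    by (intro poly_mapping_eqI) (simp add: lookup_pd)
  have "Poly_Mapping.lookup p (t + Poly_Mapping.single (VX k) 1) = 0" if "Euler_x p = 0" for t
  proof -
    have "deg_x (t + Poly_Mapping.single (VX k) 1) > 0"
      unfolding deg_x_def by (rule sum_pos2[of _ k]) (simp_all add: lookup_add)
    moreover have "of_nat (deg_x (t + Poly_Mapping.single (VX k) 1))
        * Poly_Mapping.lookup p (t + Poly_Mapping.single (VX k) 1) = 0"
      using that by (simp flip: lookup_Euler(1))
    ultimately show ?thesis by simp
  qed
  then show "Euler_x p = 0 \<Longrightarrow> pd (VX k) p = 0"
    by (intro poly_mapping_eqI) (simp add: lookup_pd)
qed

lemma x_dy_eq_0: "Euler_y p = 0 \<Longrightarrow> x_dy p = 0"
  by (simp add: x_dy_def pd_VY_eq_0)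

lemma y_dx_eq_0: "Euler_x p = 0 \<Longrightarrow> y_dx p = 0"
  by (simp add: y_dx_def pd_VX_eq_0)

lemma weight_space_Euler_z:
  fixes p :: "'m::finite cpoly"
  assumes "p \<in> weight_space a"
  shows "Euler_z p + 2 *\<^sub>P Euler_y p = of_nat a *\<^sub>P p"
proof (rule poly_mapping_eqI)
  fix t
  show "Poly_Mapping.lookup (Euler_z p + 2 *\<^sub>P Euler_y p) t
      = Poly_Mapping.lookup (of_nat a *\<^sub>P p) t"
  proof (cases "Poly_Mapping.lookup p t = 0")
    case False
    then have "a = 2 * deg_y t + deg_z t"
      using assms by (simp add: weight_space_iff in_keys_iff)
    then show ?thesis
      by (simp add: lookup_add lookup_Euler lookup_cscale algebra_simps)
  qed (simp add: lookup_add lookup_Euler lookup_cscale)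
qed

section \<open>Tensor products described by operator equations\<close>

lemma tensor_subset:
  assumes "cpoly_subspace S" "\<And>j w. w \<in> W \<Longrightarrow> g j * w \<in> S"
  shows "cpoly_span (range g) \<otimes>\<^sub>P W \<subseteq> S"
  unfolding tensor_def
proof (rule cpoly.span_minimal[OF _ assms(1)], clarify)
  fix u w assume u: "u \<in> cpoly_span (range g)" and w: "w \<in> W"
  have "cpoly_span (range g) \<subseteq> {u. u * w \<in> S}"
    by (rule cpoly.span_minimal)
       (use assms(1) assms(2)[OF w] in \<open>auto simp: cpoly.subspace_def distrib_right cscale_mult_left\<close>)
  with u show "u * w \<in> S" by blast
qed

lemma sum_in_tensor:
  assumes "\<And>j. h j \<in> W"
  shows "(\<Sum>j\<in>J. g j * h j) \<in> cpoly_span (range g) \<otimes>\<^sub>P W"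
  unfolding tensor_def
  by (intro cpoly.span_sum cpoly.span_base) (use assms cpoly.span_base in blast)

text \<open>On \<open>P1\<close> the operators \<open>Euler_x\<close> and \<open>Euler_y\<close> are
  complementary projections onto the parts linear in x and in y.\<close>

lemma Euler_y_in_P1:
  assumes "p \<in> P1"
  shows "Euler_x (Euler_y p) = 0" "Euler_y (Euler_y p) = Euler_y p"
proof -
  have "of_nat (deg_x t) * (of_nat (deg_y t) * Poly_Mapping.lookup p t) = 0" for t
  proof (cases "Poly_Mapping.lookup p t = 0")
    case False
    then have "deg_x t + deg_y t = 1" using assms by (simp add: P1_def in_keys_iff)
    then show ?thesis by (cases "deg_x t") auto
  qed simp
  then show "Euler_x (Euler_y p) = 0"
    by (intro poly_mapping_eqI) (simp only: lookup_Euler lookup_zero)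
  moreover have "Euler_y (Euler_x p + Euler_y p) = Euler_y p"
    using assms by (simp add: P1_iff)
  ultimately show "Euler_y (Euler_y p) = Euler_y p"
    by (simp add: lin_add[OF linear_vector_fields(4)] Euler_commute)
qed

text \<open>For the harder inclusion, Euler's identity writes \<open>p\<close> as the sum of x_k
  times its x_k-derivative, and these derivatives are harmonic of degree \<open>a\<close> in
  z.\<close>

lemma one_x_tensor_harm_z: "one_x \<otimes>\<^sub>P harm_z a = {p \<in> singular a. Euler_y p = 0}"
proof
  have "px j * w \<in> {p \<in> singular a. Euler_y p = 0}" if "w \<in> harm_z a" for j and w :: "'a cpoly"
  proof -
    have w: "Euler_x w = 0" "Euler_y w = 0" "Euler_z w = of_nat a *\<^sub>P w" "Lap_z w = 0"
      using that by (simp_all add: harm_z_iff)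
    then have "x_dy w = 0" by (simp add: x_dy_eq_0)
    moreover have "Lap_z (px j * w) = 0"
      using w by (simp add: Lap_z_mult_indep pd_Var)
    ultimately show ?thesis
      using w by (simp add: singular_def weight_space_def P1_iff weight_def op_E_def op_L_eq
        derivation_vector_fields[THEN derivation_mult] vector_fields_Var cscale_mult_right
        cscale_algebra)
  qed
  moreover have "cpoly_subspace {p \<in> singular a. Euler_y p = (0 :: 'a cpoly)}"
    using cpoly.subspace_inter[OF subspace_singular subspace_kernel[OF linear_vector_fields(4)]]
    by (simp add: Int_def)
  ultimately show "one_x \<otimes>\<^sub>P harm_z a \<subseteq> {p \<in> singular a. Euler_y p = (0 :: 'a cpoly)}"
    unfolding one_x_def by (intro tensor_subset)
next
  show "{p \<in> singular a. Euler_y p = (0 :: 'a cpoly)} \<subseteq> one_x \<otimes>\<^sub>P harm_z a"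
  proof clarify
    fix p :: "'a cpoly" assume p: "p \<in> singular a" and y: "Euler_y p = 0"
    then have x: "Euler_x p = p"
      by (simp add: singular_def weight_space_def P1_iff)
    have "pd (VX k) p \<in> harm_z a" for k
      unfolding harm_z_iff
    proof (intro conjI)
      show "Euler_x (pd (VX k) p) = 0"
        using pd_VX_commute(2)[of k p] x by simp
      show y': "Euler_y (pd (VX k) p) = 0"
        using pd_VX_commute(3)[of k p] y by (simp add: derivations_at_0)
      have "Euler_z p = of_nat a *\<^sub>P p"
        using weight_space_Euler_z[of p a] p y by (simp add: singular_def)
      then show "Euler_z (pd (VX k) p) = of_nat a *\<^sub>P pd (VX k) p"
        using pd_VX_commute(4)[of k p] by (simp add: lin_scale[OF linear_pd])
      have "op_L p = 0" using p by (simp add: singular_def)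
      then have "Lap_z p = 0" using y by (simp add: op_L_eq x_dy_eq_0)
      then show "Lap_z (pd (VX k) p) = 0"
        by (simp add: Lap_z_derivations_commute derivations_at_0)
    qed
    then have "(\<Sum>k\<in>UNIV. px k * pd (VX k) p) \<in> one_x \<otimes>\<^sub>P harm_z a"
      unfolding one_x_def by (rule sum_in_tensor)
    then show "p \<in> one_x \<otimes>\<^sub>P harm_z a"
      using x by (simp add: Euler_x_def)
  qed
qed

lemma subspace_Euler_x_Lap_z_kernel:
  "cpoly_subspace {p \<in> weight_space a. Euler_x p = 0 \<and> Lap_z p = 0}"
  using cpoly.subspace_inter[OF subspace_weight_space cpoly.subspace_inter[OF
      subspace_kernel[OF linear_vector_fields(3)] subspace_kernel[OF linear_Lap_z]]]
  by (simp add: Int_def)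

text \<open>The proof again uses Euler's identity, now in y. The weight index is
  \<open>b + 2\<close> because a factor y counts twice in 2 deg_y + deg_z.\<close>

lemma one_y_tensor_harm_z:
  "one_y \<otimes>\<^sub>P harm_z b = {p \<in> weight_space (b + 2). Euler_x p = 0 \<and> Lap_z p = 0}"
proof
  have "py j * w \<in> {p \<in> weight_space (b + 2). Euler_x p = 0 \<and> Lap_z p = 0}"
    if "w \<in> harm_z b" for j and w :: "'a cpoly"
  proof -
    have w: "Euler_x w = 0" "Euler_y w = 0" "Euler_z w = of_nat b *\<^sub>P w" "Lap_z w = 0"
      using that by (simp_all add: harm_z_iff)
    moreover have "Lap_z (py j * w) = 0"
      using w by (simp add: Lap_z_mult_indep pd_Var)
    ultimately show ?thesis
      by (simp add: weight_space_def P1_iff weight_def op_E_def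
        derivation_vector_fields[THEN derivation_mult] vector_fields_Var cscale_mult_right
        cscale_algebra double_cscale)
  qed
  then show "one_y \<otimes>\<^sub>P harm_z b
      \<subseteq> {p \<in> weight_space (b + 2). Euler_x p = 0 \<and> Lap_z p = (0 :: 'a cpoly)}"
    unfolding one_y_def by (intro tensor_subset subspace_Euler_x_Lap_z_kernel)
next
  show "{p \<in> weight_space (b + 2). Euler_x p = 0 \<and> Lap_z p = (0 :: 'a cpoly)}
      \<subseteq> one_y \<otimes>\<^sub>P harm_z b"
  proof clarify
    fix p :: "'a cpoly"
    assume p: "p \<in> weight_space (b + 2)" and x: "Euler_x p = 0" and L: "Lap_z p = 0"
    then have y: "Euler_y p = p"
      by (simp add: weight_space_def P1_iff)
    have "pd (VY k) p \<in> harm_z b" for k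
      unfolding harm_z_iff
    proof (intro conjI)
      show "Euler_x (pd (VY k) p) = 0"
        using pd_VY_commute(2)[of k p] x by (simp add: derivations_at_0)
      show "Euler_y (pd (VY k) p) = 0"
        using pd_VY_commute(3)[of k p] y by simp
      have "Euler_z p = of_nat b *\<^sub>P p"
        using weight_space_Euler_z[OF p] y by (simp add: cpoly.scale_left_distrib)
      then show "Euler_z (pd (VY k) p) = of_nat b *\<^sub>P pd (VY k) p"
        using pd_VY_commute(4)[of k p] by (simp add: lin_scale[OF linear_pd])
      show "Lap_z (pd (VY k) p) = 0"
        using L by (simp add: Lap_z_derivations_commute derivations_at_0)
    qed
    then have "(\<Sum>k\<in>UNIV. py k * pd (VY k) p) \<in> one_y \<otimes>\<^sub>P harm_z b"
      unfolding one_y_def by (rule sum_in_tensor)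
    then show "p \<in> one_y \<otimes>\<^sub>P harm_z b"
      using y by (simp add: Euler_y_def)
  qed
qed

section \<open>The projection \<open>Pi_L\<close>\<close>

lemma lookup_Var_mult_eq_0:
  assumes "Poly_Mapping.lookup t v = 0"
  shows "Poly_Mapping.lookup (Var v * p) t = 0"
  by (induction p rule: cpoly_monomial_induct)
     (use assms in \<open>auto simp: Var_mult_single lookup_single distrib_left lookup_add when_def\<close>)

text \<open>Each term of \<open>op_R\<close> carries a factor from y or z. This excludes the pure
  x-monomials from the image of \<open>op_R\<close>.\<close>

lemma lookup_op_R_eq_0:
  assumes "deg_y t = 0" "deg_z t = 0"
  shows "Poly_Mapping.lookup (op_R p) t = 0"
  using assms
  by (simp add: op_R_def norm2_z_def lookup_add lookup_sum lookup_cscale lookup_Var_mult_eq_0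
      deg_y_def deg_z_def sum_distrib_right power2_eq_square mult.assoc)

text \<open>A monomial of \<open>P1\<close> in the kernel satisfies 2 deg_y + deg_z = 3 - m/2, which
  for m \<ge> 6 forces both degrees to be 0. Such monomials do not occur in the image of
  \<open>op_R\<close>.\<close>

lemma inj_op_E_minus_2:
  assumes "CARD('m::finite) \<ge> 6"
  shows "inj_on (\<lambda>q. op_E q - 2 *\<^sub>P q) ((\<lambda>q. op_R (op_L q)) ` (P1 :: 'm cpoly set))"
proof (rule inj_onI, clarify)
  fix p q :: "'m cpoly"
  assume pq: "p \<in> P1" "q \<in> P1"
    and eq: "op_E (op_R (op_L p)) - 2 *\<^sub>P op_R (op_L p) = op_E (op_R (op_L q)) - 2 *\<^sub>P op_R (op_L q)"
  define d where "d = op_R (op_L (p - q))"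
  have d: "d = op_R (op_L p) - op_R (op_L q)"
    by (simp add: d_def lin_diff[OF linear_op_L] lin_diff[OF linear_op_R])
  have "p - q \<in> P1" using pq by (intro cpoly.subspace_diff subspace_P1)
  then have "d \<in> P1" by (simp add: d_def P1_iff total_degree_op_L total_degree_op_R)
  have E: "op_E d = 2 *\<^sub>P d"
    using eq by (simp add: d lin_diff[OF linear_op_E] cpoly.scale_right_diff_distrib algebra_simps)
  have "t \<notin> Poly_Mapping.keys d" for t
  proof
    assume t: "t \<in> Poly_Mapping.keys d"
    have deg: "deg_x t + deg_y t = 1" using t \<open>d \<in> P1\<close> by (auto simp: P1_def)
    have "deg_y t \<noteq> 0 \<or> deg_z t \<noteq> 0"
      using t lookup_op_R_eq_0[of t] by (auto simp: d_def in_keys_iff)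
    moreover have "of_nat (deg_y t) - of_nat (deg_x t) + of_nat (deg_z t) + of_nat CARD('m) / 2
        = (2 :: complex)"
      using arg_cong[OF E, of "\<lambda>q. Poly_Mapping.lookup q t"] t
      by (simp add: lookup_op_E lookup_cscale in_keys_iff)
    then have "Re (of_nat (deg_y t) - of_nat (deg_x t) + of_nat (deg_z t) + of_nat CARD('m) / 2) = 2"
      by simp
    then have "real (deg_y t) - real (deg_x t) + real (deg_z t) + real CARD('m) / 2 = 2"
      by simp
    ultimately show False using assms deg by linarith
  qed
  then have "d = 0" by (metis equals0I keys_eq_empty)
  with d show "op_R (op_L p) = op_R (op_L q)" by simp
qed

text \<open>Only \<open>x_dy\<close> acts on a harmonic y-part. It leads to a harmonic x-part, which
  \<open>op_L\<close> kills, and \<open>y_dx\<close> carries this back to \<open>q\<close>.\<close>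

lemma op_L_one_y_harm_z:
  assumes "q \<in> weight_space a" "Euler_x q = 0" "Lap_z q = 0"
  shows "op_L q = x_dy q" "op_L (op_L q) = 0" "Euler_y (op_L q) = 0"
    "op_R (op_L q) = q + (1/2) *\<^sub>P (norm2_z * op_L q)"
proof -
  have y: "Euler_y q = q" using assms by (simp add: weight_space_def P1_iff)
  show 1: "op_L q = x_dy q" using assms by (simp add: op_L_eq)
  show 2: "Euler_y (op_L q) = 0" by (simp add: 1 Euler_x_dy_y_dx y)
  show "op_L (op_L q) = 0"
    using 2 assms(3) by (simp add: 1 op_L_eq x_dy_eq_0 Lap_z_derivations_commute derivations_at_0)
  have "y_dx (x_dy q) = q"
    using x_dy_y_dx[of q] assms(2) y by (simp add: y_dx_eq_0 derivations_at_0 algebra_simps)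
  then show "op_R (op_L q) = q + (1/2) *\<^sub>P (norm2_z * op_L q)"
    by (simp add: 1 op_R_eq)
qed

text \<open>As \<open>op_R (op_L q)\<close> has the same \<open>op_E\<close>-eigenvalue as
  \<open>q\<close>, inverting \<open>op_E - 2\<close> on it is division by
  \<open>weight TYPE('m) b\<close>.\<close>

lemma Pi_L_eq:
  fixes q :: "'m::finite cpoly"
  assumes m: "CARD('m) \<ge> 6" and q: "q \<in> weight_space (b + 2)" "Euler_x q = 0" "Lap_z q = 0"
  shows "Pi_L q = q + inverse (weight TYPE('m) b) *\<^sub>P op_R (op_L q)"
proof -
  let ?w = "weight TYPE('m) b"
  let ?f = "\<lambda>q :: 'm cpoly. op_E q - 2 *\<^sub>P q" and ?S = "(\<lambda>q. op_R (op_L q)) ` (P1 :: 'm cpoly set)"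
  have w: "?w \<noteq> 0" using weight_plus_nonzero[where 'm = 'm, of b 0] m by simp
  have E: "op_E (op_R (op_L q)) = (?w + 2) *\<^sub>P op_R (op_L q)"
    using op_R_weight_space[OF op_L_weight_space[OF q(1)]]
    by (simp add: weight_space_def weight_add del: add_2_eq_Suc')
  have "?f (inverse ?w *\<^sub>P op_R (op_L q)) = inverse ?w *\<^sub>P (?w *\<^sub>P op_R (op_L q))"
    by (simp only: lin_scale[OF linear_op_E] E cpoly.scale_left_commute[of 2] cpoly.scale_left_distrib
        flip: cpoly.scale_right_diff_distrib) simp
  then have f: "?f (inverse ?w *\<^sub>P op_R (op_L q)) = op_R (op_L q)"
    using w by simp
  \<comment> \<open>\<open>inv_into\<close> returns the rescaled vector only once it is known to lie
    in \<open>?S\<close>.\<close>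
  have "inverse ?w *\<^sub>P q \<in> P1"
    using q(1) by (intro cpoly.subspace_scale subspace_P1) (simp add: weight_space_def)
  then have "op_R (op_L (inverse ?w *\<^sub>P q)) \<in> ?S" by (rule imageI)
  then have "inverse ?w *\<^sub>P op_R (op_L q) \<in> ?S"
    by (simp only: lin_scale[OF linear_op_L] lin_scale[OF linear_op_R])
  from inv_into_f_f[OF inj_op_E_minus_2[OF m] this] show ?thesis
    by (simp only: Pi_L_def f)
qed

text \<open>Since \<open>op_L\<close> kills \<open>op_L q\<close>, applying it to
  \<open>op_R (op_L q)\<close> gives minus the weight times \<open>op_L q\<close>, which the scalar
  in \<open>Pi_L\<close> cancels against \<open>op_L q\<close>. The y-part of
  \<open>op_R (op_L q)\<close> is \<open>q\<close> itself.\<close>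

lemma Pi_L_singular:
  fixes q :: "'m::finite cpoly"
  assumes m: "CARD('m) \<ge> 6" and q: "q \<in> weight_space (b + 2)" "Euler_x q = 0" "Lap_z q = 0"
  shows "Pi_L q \<in> singular (b + 2)"
    and "Euler_y (Pi_L q) = (1 + inverse (weight TYPE('m) b)) *\<^sub>P q"
proof -
  let ?w = "weight TYPE('m) b"
  have w: "?w \<noteq> 0" using weight_plus_nonzero[where 'm = 'm, of b 0] m by simp
  note L = op_L_one_y_harm_z[OF q]
  have "op_E (op_L q) = ?w *\<^sub>P op_L q"
    using op_L_weight_space[OF q(1)] by (simp add: weight_space_def)
  then have "op_L (op_R (op_L q)) = - (?w *\<^sub>P op_L q)"
    by (simp add: op_L_op_R L(2) lin_zero[OF linear_op_R])
  then have "op_L (Pi_L q) = 0"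
    using w by (simp add: Pi_L_eq[OF assms] lin_add[OF linear_op_L] lin_scale[OF linear_op_L])
  moreover have "Pi_L q \<in> weight_space (b + 2)"
    unfolding Pi_L_eq[OF assms]
    by (intro cpoly.subspace_add cpoly.subspace_scale subspace_weight_space q(1)
        op_R_weight_space op_L_weight_space)
  ultimately show "Pi_L q \<in> singular (b + 2)" by (simp add: singular_def)
  have y: "Euler_y q = q" using q by (simp add: weight_space_def P1_iff)
  have "Euler_y (op_R (op_L q)) = q"
    unfolding L(4)
    by (simp add: y lin_add[OF linear_vector_fields(4)] lin_scale[OF linear_vector_fields(4)]
        derivation_mult[OF derivation_vector_fields(4)] vector_fields_norm2_z L(3))
  then show "Euler_y (Pi_L q) = (1 + inverse ?w) *\<^sub>P q"
    by (simp add: Pi_L_eq[OF assms] y lin_add[OF linear_vector_fields(4)]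
        lin_scale[OF linear_vector_fields(4)] cpoly.scale_left_distrib)
qed

section \<open>Invariance of the summands and splitting of the singular vectors\<close>

lemma so_submodule_image:
  assumes "so_submodule W" "cpoly_linear T"
    "\<And>A p. transpose A = - A \<Longrightarrow> p \<in> W \<Longrightarrow> so_act A (T p) = T (so_act A p)"
  shows "so_submodule (T ` W)"
  using assms unfolding so_submodule_def by (auto intro: linear_subspace_image)

lemma so_submodule_plus:
  assumes "so_submodule V" "so_submodule W"
  shows "so_submodule (V + W)"
proof -
  have "cpoly_subspace {x + y |x y. x \<in> V \<and> y \<in> W}"
    using assms by (intro cpoly.subspace_sums) (auto simp: so_submodule_def)
  moreover have "{x + y |x y. x \<in> V \<and> y \<in> W} = V + W" by (auto simp: set_plus_def)
  moreover have "so_act A p \<in> V + W" if A: "transpose A = - A" and p: "p \<in> V + W" for A p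
  proof -
    obtain x y where "p = x + y" "x \<in> V" "y \<in> W" using p by (elim set_plus_elim)
    with assms A show ?thesis
      unfolding so_submodule_def by (auto simp: lin_add[OF linear_vector_fields(6)])
  qed
  ultimately show ?thesis by (simp add: so_submodule_def)
qed

lemma so_submodule_one_x_tensor: "so_submodule (one_x \<otimes>\<^sub>P harm_z a)"
proof -
  have "cpoly_subspace (singular a \<inter> {p. Euler_y p = 0})"
    by (intro cpoly.subspace_inter subspace_singular subspace_kernel linear_vector_fields)
  then show ?thesis
    using so_submodule_singular[of a]
    unfolding so_submodule_def one_x_tensor_harm_z
    by (auto simp: Int_def derivations_at_0 simp flip: so_act_commute)
qed

lemma so_submodule_one_y_tensor: "so_submodule (one_y \<otimes>\<^sub>P harm_z b)"
  unfolding so_submodule_def one_y_tensor_harm_z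
  by (rule conjI[OF subspace_Euler_x_Lap_z_kernel])
     (auto simp: so_act_weight_space Lap_z_so_act derivations_at_0 simp flip: so_act_commute)

lemma so_submodule_nu2:
  assumes "CARD('m::finite) \<ge> 6" "a \<ge> 2"
  shows "so_submodule (nu2 a :: 'm cpoly set)"
proof -
  \<comment> \<open>\<open>T\<close> is visibly linear and equivariant and agrees with
    \<open>Pi_L\<close> on the tensor product, so the inverse inside \<open>Pi_L\<close> need not be
    handled further.\<close>
  define T where "T q = q + inverse (weight TYPE('m) (a - 2)) *\<^sub>P op_R (op_L q)" for q :: "'m cpoly"
  have "cpoly_linear T"
    unfolding T_def by (intro linear_plus linear_cscale
      linear_compose[OF linear_op_R linear_op_L] cpoly_linearI) simp_all
  moreover have "so_act A (T p) = T (so_act A p)" if "transpose A = - A" for A p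
    using that by (simp add: T_def lin_add[OF linear_vector_fields(6)] lin_scale[OF linear_vector_fields(6)]
        so_act_op_L so_act_op_R)
  ultimately have "so_submodule (T ` (one_y \<otimes>\<^sub>P harm_z (a - 2)))"
    by (intro so_submodule_image so_submodule_one_y_tensor)
  moreover have "T ` (one_y \<otimes>\<^sub>P harm_z (a - 2)) = nu2 a"
    unfolding nu2_def
    by (intro image_cong refl) (auto simp: T_def one_y_tensor_harm_z Pi_L_eq[OF assms(1)])
  ultimately show ?thesis by simp
qed

text \<open>The number is (w + 1)/w with w and w + 1 both nonzero. It is the factor by which
  \<open>Pi_L\<close> multiplies the y-part.\<close>

lemma one_plus_inverse_weight:
  assumes "CARD('m::finite) \<ge> 6"
  shows "1 + inverse (weight TYPE('m) b) \<noteq> 0"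
proof -
  have "weight TYPE('m) b \<noteq> 0" "weight TYPE('m) b + 1 \<noteq> 0"
    using weight_plus_nonzero[where 'm = 'm, of b 0] weight_plus_nonzero[where 'm = 'm, of b 1] assms
    by simp_all
  then show ?thesis by (auto simp: field_simps)
qed

text \<open>Elements of \<open>nu1 a\<close> have no y-part, while that of \<open>Pi_L q\<close> is
  a nonzero multiple of \<open>q\<close>.\<close>

lemma nu1_Int_nu2:
  assumes "CARD('m::finite) \<ge> 6" "a \<ge> 2"
  shows "(nu1 a :: 'm cpoly set) \<inter> nu2 a = {0}"
proof -
  have "p = 0" if p: "p \<in> nu1 a" "p \<in> nu2 a" for p :: "'m cpoly"
  proof -
    obtain q where q: "q \<in> weight_space (a - 2 + 2)" "Euler_x q = 0" "Lap_z q = 0" and pq: "p = Pi_L q"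
      using p(2) by (auto simp: nu2_def one_y_tensor_harm_z)
    have "Euler_y p = 0" using p(1) by (simp add: nu1_def one_x_tensor_harm_z)
    then have "q = 0"
      using Pi_L_singular(2)[OF assms(1) q] one_plus_inverse_weight[OF assms(1)]
      by (simp add: pq)
    then show "p = 0"
      using Pi_L_eq[OF assms(1) q] by (simp add: pq lin_zero[OF linear_op_L] lin_zero[OF linear_op_R])
  qed
  moreover have "0 \<in> (nu1 a :: 'm cpoly set)" "0 \<in> (nu2 a :: 'm cpoly set)"
    using so_submodule_nu2[OF assms] so_submodule_one_x_tensor
    by (auto simp: nu1_def so_submodule_def intro: cpoly.subspace_0)
  ultimately show ?thesis by blast
qed

lemma nu1_plus_nu2:
  assumes "CARD('m::finite) \<ge> 6" "a \<ge> 2"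
  shows "nu1 a + nu2 a = (singular a :: 'm cpoly set)"
proof
  have a: "a - 2 + 2 = a" using assms(2) by simp
  show "nu1 a + nu2 a \<subseteq> (singular a :: 'm cpoly set)"
  proof
    fix p :: "'m cpoly" assume "p \<in> nu1 a + nu2 a"
    then obtain x y where p: "p = x + y" "x \<in> nu1 a" "y \<in> nu2 a" by (elim set_plus_elim)
    have "x \<in> singular a" using p(2) by (simp add: nu1_def one_x_tensor_harm_z)
    moreover have "y \<in> singular a"
      using p(3) Pi_L_singular(1)[OF assms(1), of _ "a - 2"]
      unfolding nu2_def one_y_tensor_harm_z a by blast
    ultimately show "p \<in> singular a"
      unfolding p(1) by (intro cpoly.subspace_add subspace_singular)
  qed
  show "(singular a :: 'm cpoly set) \<subseteq> nu1 a + nu2 a"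
  proof
    fix p :: "'m cpoly" assume p: "p \<in> singular a"
    then have P1: "p \<in> P1" and w: "op_E p = weight TYPE('m) a *\<^sub>P p" and L: "op_L p = 0"
      by (simp_all add: singular_def weight_space_def)
    note y = Euler_y_in_P1[OF P1]
    have xy: "Euler_y (Euler_x p) = 0" using y(1) by (simp add: Euler_commute)
    have yp: "Euler_y p = p - Euler_x p" using P1 by (simp add: P1_iff eq_diff_eq add.commute)
    \<comment> \<open>\<open>x_dy p\<close> is free of y, so the y-part of \<open>op_L p = 0\<close>
      says that the y-part of \<open>p\<close> is harmonic.\<close>
    have "Euler_y (x_dy p) = 0"
      using Euler_x_dy_y_dx(2)[of p] x_dy_eq_0[OF xy]
      by (simp add: yp lin_diff[OF linear_vector_fields(1)])
    moreover have "Euler_y (op_L p) = 0" using L by (simp add: derivations_at_0)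
    ultimately have "Lap_z (Euler_y p) = 0"
      by (simp add: op_L_eq lin_diff[OF linear_vector_fields(4)] lin_scale[OF linear_vector_fields(4)]
          Lap_z_derivations_commute)
    define c where "c = 1 + inverse (weight TYPE('m) (a - 2))"
    have c: "c \<noteq> 0" using one_plus_inverse_weight[OF assms(1)] by (simp add: c_def)
    \<comment> \<open>Scaled so that \<open>Pi_L q\<close> and \<open>p\<close> have the same
      y-part.\<close>
    define q where "q = inverse c *\<^sub>P Euler_y p"
    have "Euler_y p \<in> weight_space a"
      using arg_cong[OF w, of Euler_y] y
      by (simp add: weight_space_def P1_iff op_E_def linear_vector_fields[THEN lin_add]
        linear_vector_fields[THEN lin_diff] linear_vector_fields[THEN lin_scale] Euler_commute)
    then have q: "q \<in> weight_space (a - 2 + 2)" "Euler_x q = 0" "Lap_z q = 0"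
      using y(1) \<open>Lap_z (Euler_y p) = 0\<close>
      by (simp_all add: q_def a lin_scale[OF linear_vector_fields(3)] lin_scale[OF linear_Lap_z]
          cpoly.subspace_scale[OF subspace_weight_space] del: add_2_eq_Suc')
    have "Euler_y (p - Pi_L q) = 0"
      using Pi_L_singular(2)[OF assms(1) q] c
      by (simp add: lin_diff[OF linear_vector_fields(4)] q_def flip: c_def)
    moreover have "p - Pi_L q \<in> singular a"
      using Pi_L_singular(1)[OF assms(1) q] p unfolding a
      by (intro cpoly.subspace_diff subspace_singular)
    ultimately have "p - Pi_L q \<in> nu1 a" by (simp add: nu1_def one_x_tensor_harm_z)
    moreover have "Pi_L q \<in> nu2 a"
      using q by (simp add: nu2_def one_y_tensor_harm_z)
    ultimately have "(p - Pi_L q) + Pi_L q \<in> nu1 a + nu2 a" by (rule set_plus_intro)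
    then show "p \<in> nu1 a + nu2 a" by simp
  qed
qed

text \<open>A factor y would already contribute 2 to the weight index, so no y-part can
  occur.\<close>

lemma singular_lt_2:
  assumes "a < 2"
  shows "one_x \<otimes>\<^sub>P harm_z a = singular a"
proof -
  have "Euler_y p = 0" if "p \<in> singular a" for p :: "'a cpoly"
  proof (rule poly_mapping_eqI)
    fix t
    show "Poly_Mapping.lookup (Euler_y p) t = Poly_Mapping.lookup 0 t"
    proof (cases "Poly_Mapping.lookup p t = 0")
      case False
      then have "2 * deg_y t + deg_z t = a"
        using that by (simp add: singular_def weight_space_iff in_keys_iff)
      with assms show ?thesis by (simp add: lookup_Euler)
    qed (simp add: lookup_Euler)
  qed
  then show ?thesis by (auto simp: one_x_tensor_harm_z)
qed

lemma nu2'_eq: "nu2' = singular 1"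
  by (simp add: nu2'_def singular_lt_2)

text \<open>Harmonic polynomials of degree 0 are the constants, so tensoring with them changes
  nothing and the case \<open>a = 0\<close> of \<open>singular_lt_2\<close> applies.\<close>

lemma nu1'_eq: "nu1' = singular 0"
proof -
  have "one_x \<otimes>\<^sub>P harm_z 0 = (one_x :: 'a cpoly set)"
  proof
    have "px j * w \<in> one_x" if "w \<in> harm_z 0" for j and w :: "'a cpoly"
    proof -
      have "t = 0" if "t \<in> Poly_Mapping.keys w" for t
      proof (rule poly_mapping_eqI)
        fix v
        have "deg_x t = 0" "deg_y t = 0" "deg_z t = 0"
          using \<open>w \<in> harm_z 0\<close> that by (auto simp: harm_z_def)
        then show "Poly_Mapping.lookup t v = Poly_Mapping.lookup 0 v"
          by (cases v) (simp_all add: deg_x_def deg_y_def deg_z_def)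
      qed
      then have "w = Poly_Mapping.single 0 (Poly_Mapping.lookup w 0)"
        by (intro poly_mapping_eqI) (auto simp: lookup_single when_def in_keys_iff)
      then have "px j * w = Poly_Mapping.lookup w 0 *\<^sub>P px j"
        by (metis cscale_def mult.commute)
      then show ?thesis
        by (simp add: one_x_def cpoly.span_scale cpoly.span_base)
    qed
    then show "one_x \<otimes>\<^sub>P harm_z 0 \<subseteq> (one_x :: 'a cpoly set)"
      unfolding one_x_def by (intro tensor_subset cpoly.subspace_span)
    have "1 \<in> (harm_z 0 :: 'a cpoly set)"
      by (simp add: harm_z_iff derivations_at_1 Lap_z_def derivations_at_0)
    then show "(one_x :: 'a cpoly set) \<subseteq> one_x \<otimes>\<^sub>P harm_z 0"
      unfolding tensor_def by (metis (mono_tags, lifting) cpoly.span_base mem_Collect_eq mult.right_neutral subsetI)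
  qed
  then show ?thesis by (simp add: nu1'_def flip: singular_lt_2)
qed

section \<open>Assembly of the direct sum\<close>

lemma so_submodule_op_R_power: "so_submodule W \<Longrightarrow> so_submodule ((op_R ^^ j) ` W)"
proof (induction j)
  case (Suc j)
  then show ?case
    using so_submodule_image[of "(op_R ^^ j) ` W" op_R]
    by (simp add: image_image linear_op_R so_act_op_R)
qed simp

theorem theorem4p12:
  assumes "CARD('m::finite) \<ge> 6"
  shows "(so_submodule (nu1' :: 'm cpoly set) \<and> so_submodule (nu2' :: 'm cpoly set) \<and>
      (nu1' :: 'm cpoly set) \<inter> nu2' = {0}) \<and>
    (\<forall>a\<ge>2. so_submodule (nu1 a :: 'm cpoly set) \<and> so_submodule (nu2 a :: 'm cpoly set) \<and>
      (nu1 a :: 'm cpoly set) \<inter> nu2 a = {0}) \<and>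
    so_direct_sum (P1 :: 'm cpoly set) ((UNIV :: nat set) <+> ((UNIV :: nat set) \<times> {2..}))
      (case_sum (\<lambda>j. (op_R ^^ j) ` (nu1' + nu2')) (\<lambda>(j, a). (op_R ^^ j) ` (nu1 a + nu2 a)))"
proof (intro conjI allI impI)
  show nu': "so_submodule (nu1' :: 'm cpoly set)" "so_submodule (nu2' :: 'm cpoly set)"
    by (simp_all add: nu1'_eq nu2'_eq so_submodule_singular)
  show nu: "so_submodule (nu1 a :: 'm cpoly set)" "so_submodule (nu2 a :: 'm cpoly set)"
    and "(nu1 a :: 'm cpoly set) \<inter> nu2 a = {0}" if "a \<ge> 2" for a
    using that assms by (simp_all add: nu1_def[symmetric] so_submodule_one_x_tensor[folded nu1_def]
        so_submodule_nu2 nu1_Int_nu2)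
  have "p = 0" if "p \<in> singular 0" "p \<in> singular 1" for p :: "'m cpoly"
  proof -
    have "weight TYPE('m) 0 *\<^sub>P p = weight TYPE('m) 1 *\<^sub>P p"
      using that by (simp add: singular_def weight_space_def)
    then show ?thesis by (simp add: weight_def)
  qed
  then show "(nu1' :: 'm cpoly set) \<inter> nu2' = {0}"
    using subspace_singular[of 0, where 'a = 'm] subspace_singular[of 1, where 'a = 'm]
    by (auto simp: nu1'_eq nu2'_eq cpoly.subspace_def simp del: One_nat_def)
  let ?I = "(UNIV :: nat set) <+> ((UNIV :: nat set) \<times> {2..})"
  let ?W = "case_sum (\<lambda>j. (op_R ^^ j) ` (nu1' + nu2'))
      (\<lambda>(j, a). (op_R ^^ j) ` (nu1 a + nu2 a)) :: _ \<Rightarrow> 'm cpoly set"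
  have W: "so_submodule (?W i)" if "i \<in> ?I" for i
    using that nu nu'
    by (auto intro!: so_submodule_op_R_power so_submodule_plus)
  have W_Inl: "?W (Inl j) = (op_R ^^ j) ` (singular 0 + singular 1)" for j
    by (simp add: nu1'_eq nu2'_eq)
  have W_Inr: "?W (Inr (j, a)) = (op_R ^^ j) ` singular a" if "a \<ge> 2" for j a
    using nu1_plus_nu2[OF assms that] by simp
  show "so_direct_sum (P1 :: 'm cpoly set) ?I ?W"
  proof (rule so_direct_sumI[OF so_submodule_P1 W])
    fix f i assume f: "f \<in> ext_sum ?I ?W" and sum: "(\<Sum>i | f i \<noteq> 0. f i) = 0"
    have fW: "f i \<in> ?W i" if "i \<in> ?I" for i
      using f that unfolding ext_sum_def by blast
    define J where "J = {j. f (Inl j) \<noteq> 0}"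
    define K where "K = {k. f (Inr k) \<noteq> 0}"
    have S: "{i. f i \<noteq> 0} = J <+> K"
    proof (rule set_eqI)
      fix i show "i \<in> {i. f i \<noteq> 0} \<longleftrightarrow> i \<in> J <+> K"
        by (cases i) (auto simp: J_def K_def)
    qed
    have fin: "finite J" "finite K"
      using f by (simp_all add: ext_sum_def S finite_Plus_iff)
    have K: "K \<subseteq> UNIV \<times> {2..}"
      using f by (auto simp: K_def ext_sum_def)
    have "\<exists>p q. p \<in> singular 0 \<and> q \<in> singular 1 \<and> f (Inl j) = (op_R ^^ j) p + (op_R ^^ j) q" for j
    proof -
      have "f (Inl j) \<in> ?W (Inl j)" by (rule fW) auto
      then show ?thesis unfolding W_Inl
        by (auto elim!: set_plus_elim simp: lin_add[OF linear_power[OF linear_op_R]]) blast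
    qed
    then obtain p q where pq: "\<And>j. p j \<in> singular 0" "\<And>j. q j \<in> singular 1"
      "\<And>j. f (Inl j) = (op_R ^^ j) (p j) + (op_R ^^ j) (q j)" by metis
    \<comment> \<open>The summand at \<open>Inl j\<close> is split into its parts over
      \<open>singular 0\<close> and \<open>singular 1\<close>. Everything is then indexed by pairs
      \<open>(j, a)\<close>, as the independence result for towers requires.\<close>
    define g where "g = (\<lambda>(j, a). if a = 0 then (op_R ^^ j) (p j)
        else if a = 1 then (op_R ^^ j) (q j) else f (Inr (j, a)))"
    have gK: "g k = f (Inr k)" if "k \<in> K" for k
      using that K by (auto simp: g_def)
    \<comment> \<open>The two index sets are disjoint because pairs in \<open>K\<close> have second
      component at least 2.\<close>
    have "(\<Sum>i\<in>J \<times> {0, 1} \<union> K. g i) = (\<Sum>i\<in>J \<times> {0, 1}. g i) + (\<Sum>k\<in>K. g k)"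
      using fin K by (intro sum.union_disjoint) auto
    also have "(\<Sum>i\<in>J \<times> {0, 1}. g i) = (\<Sum>j\<in>J. f (Inl j))"
      by (simp add: sum.cartesian_product[symmetric] g_def pq(3))
    also have "(\<Sum>k\<in>K. g k) = (\<Sum>k\<in>K. f (Inr k))"
      by (rule sum.cong[OF refl gK])
    also have "(\<Sum>j\<in>J. f (Inl j)) + (\<Sum>k\<in>K. f (Inr k)) = 0"
      using sum fin by (simp add: S sum.Plus)
    finally have sum_g: "(\<Sum>i\<in>J \<times> {0, 1} \<union> K. g i) = 0" .
    have g: "g (j, a) \<in> (op_R ^^ j) ` singular a" if "(j, a) \<in> J \<times> {0, 1} \<union> K" for j a
    proof (cases "a < 2")
      case True
      then show ?thesis using pq(1,2)[of j] by (auto simp: g_def less_2_cases_iff)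
    next
      case False
      moreover have "f (Inr (j, a)) \<in> ?W (Inr (j, a))"
        using False by (intro fW) auto
      ultimately show ?thesis using W_Inr[of a j] by (simp add: g_def)
    qed
    have zero: "g i = 0" if "i \<in> J \<times> {0, 1} \<union> K" for i
      by (rule op_R_power_singular_independent[OF _ _ g sum_g that]) (use assms fin in auto)
    have "f (Inl j) = 0" for j
      using zero[of "(j, 0)"] zero[of "(j, 1)"] pq(3)[of j]
      by (cases "j \<in> J") (auto simp: g_def J_def)
    moreover have "f (Inr k) = 0" for k
      using zero[of k] gK[of k] by (cases "k \<in> K") (auto simp: K_def)
    ultimately show "f i = 0" by (cases i) simp_all
  next
    have "?W i \<subseteq> P1" if "i \<in> ?I" for i
    proof (cases i)
      case (Inl j)
      show ?thesis unfolding Inl W_Inl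
        by (auto elim!: set_plus_elim simp: lin_add[OF linear_power[OF linear_op_R]]
            intro!: cpoly.subspace_add[OF subspace_P1] dest: op_R_power_P1)
    next
      case (Inr k)
      then show ?thesis using that
        by (cases k) (auto simp: nu1_plus_nu2[OF assms] dest: op_R_power_P1)
    qed
    then have "cpoly_span (\<Union>i\<in>?I. ?W i) \<subseteq> P1"
      by (intro cpoly.span_minimal subspace_P1) blast
    moreover have "P1 \<subseteq> cpoly_span (\<Union>i\<in>?I. ?W i)"
    proof (rule subset_trans[OF P1_subset_span cpoly.span_mono])
      show "CARD('m) \<ge> 3" using assms by simp
      have "(op_R ^^ j) p \<in> (\<Union>i\<in>?I. ?W i)" if p: "p \<in> singular a" for j a p
      proof (cases "a < 2")
        case True
        have "(0 :: 'm cpoly) \<in> singular b" for b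
          by (rule cpoly.subspace_0[OF subspace_singular])
        \<comment> \<open>For \<open>a < 2\<close> the generator belongs to an \<open>Inl\<close>
          summand; the missing component is filled with 0.\<close>
        then have "p \<in> singular 0 + singular 1"
          using True p set_plus_intro[of p "singular 0" 0 "singular 1"]
            set_plus_intro[of 0 "singular 0" p "singular 1"] by (auto simp: less_2_cases_iff)
        then have "(op_R ^^ j) p \<in> ?W (Inl j)" unfolding W_Inl by (rule imageI)
        then show ?thesis by blast
      next
        case False
        then have "(op_R ^^ j) p \<in> ?W (Inr (j, a))" using p W_Inr[of a j] by simp
        moreover have "Inr (j, a) \<in> ?I" using False by auto
        ultimately show ?thesis by blast
      qed
      then show "{(op_R ^^ j) p |j a p. p \<in> (singular a :: 'm cpoly set)} \<subseteq> (\<Union>i\<in>?I. ?W i)"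
        by blast
    qed
    ultimately show "(P1 :: 'm cpoly set) = cpoly_span (\<Union>i\<in>?I. ?W i)" by blast
  qed
qed

end
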